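(* Let $m\ge 2$. Let $G_1$ be a connected $m$-uniform hypergraph on $n_{G_1}$ vertices whose incidence matrix $\mathrm{Inc}(G_1)$ has invariant divisors $d_1,\dots,d_{r_{G_1}}$ over $\mathbb{Z}_m$, and let $G_2$ be a connected $m$-uniform hypergraph on $n_{G_2}$ vertices whose incidence matrix $\mathrm{Inc}(G_2)$ has invariant divisors $\bar d_1,\dots,\bar d_{r_{G_2}}$ over $\mathbb{Z}_m$. Then \[ s(G_1\Box G_2)=m^{(n_{G_1}-r_{G_1})(n_{G_2}-r_{G_2})-1}\prod_{i\in[r_{G_1}],\, j\in[r_{G_2}]}\gcd(d_i,\bar d_j)\prod_{i\in[r_{G_1}]} d_i^{\,n_{G_2}-r_{G_2}}\prod_{j\in[r_{G_2}]}\bar d_j^{\,n_{G_1}-r_{G_1}}. \] In particular, if $m$ is prime, then $s(G_1\Box G_2)=m^{(n_{G_1}-r_{G_1})(n_{G_2}-r_{G_2})-1}$, where $r_{G_1},r_{G_2}$ are the ranks of $\mathrm{Inc}(G_1),\mathrm{Inc}(G_2)$ over the field $\mathbb{Z}_m$.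
   Context: An $m$-uniform hypergraph $G=(V,E)$ has finite vertex set $V=\{v_1,\dots,v_n\}$ and edge set $E$ of $m$-element subsets of $V$; it is connected if any two vertices are joined by a walk $v_0e_1v_1\dots e_tv_t$ ($v_{i-1}\ne v_i$, $\{v_{i-1},v_i\}\subseteq e_i$). Its incidence matrix $\mathrm{Inc}(G)=(\gamma_{e,v})$ is the $|E|\times|V|$ matrix with $\gamma_{e,v}=1$ if $v\in e$ and $0$ otherwise. For $B\in\mathbb{Z}_m^{k\times n}$ there are invertible $P,Q$ over $\mathbb{Z}_m$ with $PBQ$ having diagonal entries $d_1,\dots,d_r,0,\dots,0$ and zeros elsewhere, where $r\ge0$, $1\le d_i\le m-1$, $d_i\mid d_{i+1}$ and $d_i\mid m$ (Smith normal form over $\mathbb{Z}_m$); $d_1,\dots,d_r$ are the invariant divisors of $B$ over $\mathbb{Z}_m$, and $r$ is their number. The Cartesian product $G\Box H$ has vertex set $V(G)\times V(H)$, and $\{(i_1,j_1),\dots,(i_m,j_m)\}$ is an edge iff either $i_1=\dots=i_m$ and $\{j_1,\dots,j_m\}\in E(H)$, or $j_1=\dots=j_m$ and $\{i_1,\dots,i_m\}\in E(G)$. The adjacency tensor $\mathcal{A}(G)=(a_{i_1\dots i_m})$ is the order-$m$, dimension-$n$ tensor with $a_{i_1\dots i_m}=\frac{1}{(m-1)!}$ if $\{v_{i_1},\dots,v_{i_m}\}\in E$ and $0$ otherwise. For an order-$m$, dimension-$n$ tensor $\mathcal{A}$, $s(\mathcal{A})$ is the cardinality of the set of invertible complex diagonal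 matrices $D=\mathrm{diag}(d_1,\dots,d_n)$ with $d_1=1$ such that $d_{i_1}^{-(m-1)}a_{i_1\dots i_m}d_{i_2}\cdots d_{i_m}=a_{i_1\dots i_m}$ for all indices; $s(G):=s(\mathcal{A}(G))$ is the stabilizing index of $G$. *)

theory Defs
  imports
    Complex_Main
    "Jordan_Normal_Form.DL_Rank"
    "Berlekamp_Zassenhaus.Finite_Field"
begin

text \<open>The ring $\mathbb{Z}_m$ is rendered as the type \<open>'m mod_ring\<close> with \<open>m = CARD('m)\<close>;
  the class \<open>nontriv\<close> says \<open>m \<ge> 2\<close>.\<close>

definition uniform_hypergraph :: "nat \<Rightarrow> 'a set \<Rightarrow> 'a set set \<Rightarrow> bool" where
  "uniform_hypergraph m V E \<longleftrightarrow>
     finite V \<and> V \<noteq> {} \<and> (\<forall>e\<in>E. e \<subseteq> V \<and> card e = m)"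

definition hypergraph_walk :: "'a set set \<Rightarrow> 'a list \<Rightarrow> 'a set list \<Rightarrow> bool" where
  "hypergraph_walk E ws es \<longleftrightarrow>
     length ws = Suc (length es) \<and>
     (\<forall>i<length es. es ! i \<in> E \<and> ws ! i \<noteq> ws ! Suc i \<and> {ws ! i, ws ! Suc i} \<subseteq> es ! i)"

definition hypergraph_connected :: "'a set \<Rightarrow> 'a set set \<Rightarrow> bool" where
  "hypergraph_connected V E \<longleftrightarrow>
     (\<forall>u\<in>V. \<forall>v\<in>V. \<exists>ws es. hypergraph_walk E ws es \<and> hd ws = u \<and> last ws = v)"

text \<open>Edges of the Cartesian product; its vertex set is \<open>V \<times> W\<close>.\<close>

definition cartesian_edges ::
  "'a set \<Rightarrow> 'a set set \<Rightarrow> 'b set \<Rightarrow> 'b set set \<Rightarrow> ('a \<times> 'b) set set" where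
  "cartesian_edges V E W F =
     {{i} \<times> f |i f. i \<in> V \<and> f \<in> F} \<union> {e \<times> {j} |e j. e \<in> E \<and> j \<in> W}"

text \<open>Incidence matrix and adjacency tensor refer to a numbering of the vertices (and edges),
  which is passed explicitly as a list. All indices start at \<open>0\<close>.\<close>

definition enumerates :: "'a list \<Rightarrow> 'a set \<Rightarrow> bool" where
  "enumerates xs A \<longleftrightarrow> distinct xs \<and> set xs = A"

definition incidence_mat :: "'a list \<Rightarrow> 'a set list \<Rightarrow> 'r :: zero_neq_one mat" where
  "incidence_mat vs es =
     mat (length es) (length vs) (\<lambda>(i, j). if vs ! j \<in> es ! i then 1 else 0)"

definition invariant_divisors :: "'m :: nontriv mod_ring mat \<Rightarrow> nat list \<Rightarrow> bool" where
  "invariant_divisors B ds \<longleftrightarrow>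
     length ds \<le> min (dim_row B) (dim_col B) \<and>
     (\<forall>i<length ds. 1 \<le> ds ! i \<and> ds ! i \<le> CARD('m) - 1 \<and> ds ! i dvd CARD('m)) \<and>
     (\<forall>i. Suc i < length ds \<longrightarrow> ds ! i dvd ds ! Suc i) \<and>
     (\<exists>P Q. P \<in> carrier_mat (dim_row B) (dim_row B) \<and> invertible_mat P \<and>
            Q \<in> carrier_mat (dim_col B) (dim_col B) \<and> invertible_mat Q \<and>
            P * B * Q = mat (dim_row B) (dim_col B)
              (\<lambda>(i, j). if i = j \<and> i < length ds then of_nat (ds ! i) else 0))"

text \<open>The rank of a matrix as the dimension of its column space. This is verbatim
  \<open>vec_space.rank\<close>, but without the class constraint \<open>field\<close>, which \<open>'m mod_ring\<close> does not satisfy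
  as a type when primality of \<open>CARD('m)\<close> is only a hypothesis.\<close>

definition mat_rank :: "'a :: comm_ring_1 mat \<Rightarrow> nat" where
  "mat_rank A = vectorspace.dim (class_ring :: 'a ring)
     (module_vec TYPE('a) (dim_row A)
        \<lparr>carrier := LinearCombinations.module.span class_ring
                     (module_vec TYPE('a) (dim_row A)) (set (cols A))\<rparr>)"

lemma mat_rank_eq_rank: "mat_rank (A :: 'a :: field mat) = vec_space.rank (dim_row A) A"
  by (simp add: mat_rank_def vec_space.rank_def)

text \<open>An order-\<open>m\<close>, dimension-\<open>n\<close> complex tensor is a function on lists \<open>is\<close> of indices, of which
  only the values with \<open>length is = m\<close> and \<open>set is \<subseteq> {..<n}\<close> matter.\<close>

type_synonym tensor = "nat list \<Rightarrow> complex"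

definition adjacency_tensor :: "nat \<Rightarrow> 'a list \<Rightarrow> 'a set set \<Rightarrow> tensor" where
  "adjacency_tensor m vs E is = (if (\<lambda>i. vs ! i) ` set is \<in> E then 1 / fact (m - 1) else 0)"

definition tensor_stabilizers :: "nat \<Rightarrow> nat \<Rightarrow> tensor \<Rightarrow> complex mat set" where
  "tensor_stabilizers m n A =
     {D \<in> carrier_mat n n. diagonal_mat D \<and> invertible_mat D \<and> D $$ (0, 0) = 1 \<and>
        (\<forall>is. length is = m \<and> set is \<subseteq> {..<n} \<longrightarrow>
           inverse (D $$ (hd is, hd is) ^ (m - 1)) * A is * (\<Prod>i\<leftarrow>tl is. D $$ (i, i)) = A is)}"

definition stabilizing_index :: "nat \<Rightarrow> 'a list \<Rightarrow> 'a set set \<Rightarrow> nat" where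
  "stabilizing_index m vs E =
     card (tensor_stabilizers m (length vs) (adjacency_tensor m vs E))"

end

theory Submission
  imports Defs
begin

text \<open>A stabilizer of a connected hypergraph consists of \<open>m\<close>-th roots of unity, since
  \<open>d\<^sub>v\<^sup>m = \<Prod>\<^sub>u d\<^sub>u\<close> holds for all vertices \<open>v\<close> of an edge. Taking logarithms, stabilizers are the kernel
  vectors of the incidence matrix over \<open>\<int>\<^sub>m\<close> that vanish at the first vertex; as the all-one vector lies
  in the kernel, the stabilizing index is the size of the kernel divided by \<open>m\<close>. For a Cartesian
  product the kernel consists of the matrices \<open>X\<close> with \<open>B\<^sub>1 X = 0\<close> and \<open>B\<^sub>2 X\<^sup>T = 0\<close>. Substituting
  \<open>X = Q\<^sub>1 Y Q\<^sub>2\<^sup>T\<close> turns \<open>B\<^sub>1\<close> and \<open>B\<^sub>2\<close> into their Smith forms, and the conditions decouple into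
  \<open>d\<^sub>i y\<^sub>i\<^sub>j = 0\<close> and \<open>d'\<^sub>j y\<^sub>i\<^sub>j = 0\<close>, which have \<open>gcd d\<^sub>i d'\<^sub>j\<close> solutions. For prime \<open>m\<close> the rank is read off
  from the number of elements of the column space.\<close>

section \<open>Counting in \<open>\<int>\<^sub>m\<close> and Smith normal form\<close>

lemma of_nat_mod_ring_eq_0_iff:
  "(of_nat a :: 'm :: nontriv mod_ring) = 0 \<longleftrightarrow> CARD('m) dvd a"
proof -
  have "(of_nat a :: 'm mod_ring) = 0 \<longleftrightarrow> int a mod int CARD('m) = 0"
    by transfer simp
  then show ?thesis
    by (simp add: dvd_eq_mod_eq_0 flip: zmod_int)
qed

lemma to_int_mod_ring_bounds:
  fixes x :: "'m :: nontriv mod_ring"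
  shows "0 \<le> to_int_mod_ring x" "to_int_mod_ring x < int CARD('m)"
proof -
  have "to_int_mod_ring x \<in> {0..<int CARD('m)}"
    using range_to_int_mod_ring[where ?'a = 'm] by blast
  then show "0 \<le> to_int_mod_ring x" "to_int_mod_ring x < int CARD('m)" by auto
qed

lemma mod_ring_eq_of_nat:
  obtains a where "a < CARD('m)" "(y :: 'm :: nontriv mod_ring) = of_nat a"
proof
  let ?a = "nat (to_int_mod_ring y)"
  show "?a < CARD('m)" using to_int_mod_ring_bounds[of y] by (simp add: nat_less_iff)
  show "y = of_nat ?a" using to_int_mod_ring_bounds[of y] by (simp add: of_nat_of_int_mod_ring)
qed

text \<open>Writing \<open>CARD('m) = d * k\<close>, the solutions are exactly the residues of
  \<open>k * j\<close> with \<open>j < d\<close>, and these are pairwise distinct.\<close>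

lemma card_torsion_mod_ring:
  assumes "d dvd CARD('m :: nontriv)"
  shows "card {y :: 'm mod_ring. of_nat d * y = 0} = d"
proof -
  obtain k where k: "CARD('m) = d * k" using assms by (elim dvdE)
  have pos: "d > 0" "k > 0" using k zero_less_card_finite[where 'a = 'm] by (auto intro: Nat.gr0I)
  have "{y :: 'm mod_ring. of_nat d * y = 0} = (\<lambda>j. of_nat (k * j)) ` {..<d}"
  proof (intro equalityI subsetI)
    fix y :: "'m mod_ring" assume "y \<in> {y. of_nat d * y = 0}"
    moreover obtain a where a: "a < CARD('m)" "y = of_nat a" by (rule mod_ring_eq_of_nat)
    ultimately have "(of_nat (d * a) :: 'm mod_ring) = 0" by simp
    then have "d * k dvd d * a" by (simp only: of_nat_mod_ring_eq_0_iff k)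
    then obtain j where j: "a = k * j" using pos by (auto elim: dvdE)
    have "j < d" using a(1) pos by (simp add: k j mult.commute)
    then show "y \<in> (\<lambda>j. of_nat (k * j)) ` {..<d}" using a(2) j by blast
  next
    fix y :: "'m mod_ring" assume "y \<in> (\<lambda>j. of_nat (k * j)) ` {..<d}"
    then obtain j where "y = of_nat (k * j)" by blast
    then have "of_nat d * y = of_nat (d * k * j)" by (simp add: mult.assoc)
    also have "\<dots> = 0" by (simp only: of_nat_mod_ring_eq_0_iff k) simp
    finally show "y \<in> {y. of_nat d * y = 0}" by simp
  qed
  moreover have "inj_on (\<lambda>j. of_nat (k * j) :: 'm mod_ring) {..<d}"
  proof (rule linorder_inj_onI')
    fix i j assume ij: "i \<in> {..<d}" "j \<in> {..<d}" "i < j"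
    show "(of_nat (k * i) :: 'm mod_ring) \<noteq> of_nat (k * j)"
    proof
      assume "(of_nat (k * i) :: 'm mod_ring) = of_nat (k * j)"
      moreover have "k * j = k * i + k * (j - i)" using ij by (simp flip: distrib_left)
      ultimately have "(of_nat (k * (j - i)) :: 'm mod_ring) = 0"
        by (metis add_cancel_left_right of_nat_add)
      then have "k * d dvd k * (j - i)" by (simp only: of_nat_mod_ring_eq_0_iff k mult.commute)
      then have "d dvd j - i" using pos by simp
      then show False using ij by (auto dest: dvd_imp_le)
    qed
  qed
  ultimately show ?thesis by (simp add: card_image)
qed

text \<open>By Bezout the gcd is an integer combination of \<open>a\<close> and \<open>b\<close>.
  This merges the row condition and the column condition on an entry into one torsion
  condition.\<close>

lemma gcd_torsion_iff:
  fixes y :: "'a :: comm_ring_1"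
  shows "of_nat a * y = 0 \<and> of_nat b * y = 0 \<longleftrightarrow> of_nat (gcd a b) * y = 0"
proof
  assume *: "of_nat a * y = 0 \<and> of_nat b * y = 0"
  obtain u v where "u * int a + v * int b = gcd (int a) (int b)"
    using bezout_int by blast
  then have "of_nat (gcd a b) * y = of_int (u * int a + v * int b) * y"
    by (metis gcd_int_int_eq of_int_of_nat_eq)
  also have "\<dots> = of_int u * (of_nat a * y) + of_int v * (of_nat b * y)"
    by (simp add: algebra_simps)
  finally show "of_nat (gcd a b) * y = 0" using * by simp
next
  assume *: "of_nat (gcd a b) * y = 0"
  have "of_nat c * y = 0" if "gcd a b dvd c" for c
  proof -
    from that obtain k where k: "c = gcd a b * k" by (elim dvdE)
    have "of_nat c * y = of_nat k * (of_nat (gcd a b) * y)" unfolding k by (simp add: mult_ac)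
    then show ?thesis using * by simp
  qed
  then show "of_nat a * y = 0 \<and> of_nat b * y = 0" by simp
qed

section \<open>Linear systems in Smith normal form\<close>

definition smith_diag :: "nat \<Rightarrow> nat \<Rightarrow> nat list \<Rightarrow> 'a :: comm_ring_1 mat" where
  "smith_diag k n ds = mat k n (\<lambda>(i, j). if i = j \<and> i < length ds then of_nat (ds ! i) else 0)"

lemma smith_diag_dim [simp]: "dim_row (smith_diag k n ds) = k" "dim_col (smith_diag k n ds) = n"
  by (simp_all add: smith_diag_def)

text \<open>A vanishing diagonal entry of the Smith form is represented by \<open>m\<close>, which is zero in
  \<open>\<int>\<^sub>m\<close>.\<close>

definition padded_divisor :: "nat \<Rightarrow> nat list \<Rightarrow> nat \<Rightarrow> nat" where
  "padded_divisor m ds i = (if i < length ds then ds ! i else m)"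

lemma invertible_matE:
  fixes P :: "'a :: comm_ring_1 mat"
  assumes "P \<in> carrier_mat n n" "invertible_mat P"
  obtains P' where "P' \<in> carrier_mat n n" "P * P' = 1\<^sub>m n" "P' * P = 1\<^sub>m n"
proof -
  from assms obtain P' where P': "P * P' = 1\<^sub>m n" "P' * P = 1\<^sub>m (dim_row P')"
    by (auto simp: invertible_mat_def inverts_mat_def)
  \<comment> \<open>\<open>inverts_mat\<close> does not fix the size of the inverse; it is recovered
    by comparing dimensions in both identities.\<close>
  have "dim_col (P * P') = n" "dim_col (P' * P) = dim_row P'" unfolding P' by simp_all
  then have "P' \<in> carrier_mat n n" using assms(1) by auto
  then show thesis using P' that by auto
qed

lemma mult_right_invertible_eq_0_iff:
  fixes A :: "'a :: comm_ring_1 mat"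
  assumes "A \<in> carrier_mat k n" "R \<in> carrier_mat n n" "R' \<in> carrier_mat n n" "R * R' = 1\<^sub>m n"
  shows "A * R = 0\<^sub>m k n \<longleftrightarrow> A = 0\<^sub>m k n"
proof
  assume "A * R = 0\<^sub>m k n"
  then have "A * R * R' = 0\<^sub>m k n" using assms by simp
  then show "A = 0\<^sub>m k n" using assms by (simp add: assoc_mult_mat[OF assms(1-3)])
qed (use assms in simp)

lemma mult_left_invertible_eq_0_iff:
  fixes A :: "'a :: comm_ring_1 mat"
  assumes "A \<in> carrier_mat k n" "P \<in> carrier_mat k k" "P' \<in> carrier_mat k k" "P' * P = 1\<^sub>m k"
  shows "P * A = 0\<^sub>m k n \<longleftrightarrow> A = 0\<^sub>m k n"
proof
  assume "P * A = 0\<^sub>m k n"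
  then have "P' * (P * A) = 0\<^sub>m k n" using assms by simp
  then show "A = 0\<^sub>m k n" using assms by (simp flip: assoc_mult_mat[OF assms(3,2,1)])
qed (use assms in simp)

text \<open>\<open>P\<close> can be multiplied in from the left and \<open>R\<close> cancelled from
  the right without affecting vanishing, and \<open>P * B * Q = D\<close>. The factor
  \<open>R\<close> accommodates the change of coordinates belonging to the other hypergraph.\<close>

lemma smith_mult_eq_0_iff:
  fixes B :: "'a :: comm_ring_1 mat"
  assumes B: "B \<in> carrier_mat k n"
    and P: "P \<in> carrier_mat k k" "P' \<in> carrier_mat k k" "P' * P = 1\<^sub>m k"
    and Q: "Q \<in> carrier_mat n n" and PBQ: "P * B * Q = D"
    and Y: "Y \<in> carrier_mat n l"
    and R: "R \<in> carrier_mat l l" "R' \<in> carrier_mat l l" "R * R' = 1\<^sub>m l"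
  shows "B * (Q * Y * R) = 0\<^sub>m k l \<longleftrightarrow> D * Y = 0\<^sub>m k l"
proof -
  have c: "B * (Q * Y) \<in> carrier_mat k l" using B Q Y by simp
  have "B * (Q * Y * R) = B * (Q * Y) * R"
    using B Q Y R by (simp add: assoc_mult_mat[of B k n "Q * Y" l R l])
  moreover have "P * (B * (Q * Y)) = D * Y"
    using B P Q Y unfolding PBQ[symmetric]
    by (simp add: assoc_mult_mat[of _ k n _ n _ l] assoc_mult_mat[of _ k k _ n _ l] assoc_mult_mat[of _ k k _ n _ n])
  ultimately show ?thesis
    using mult_right_invertible_eq_0_iff[OF c R] mult_left_invertible_eq_0_iff[OF c P] by simp
qed

lemma smith_diag_mult_index:
  fixes Y :: "'a :: comm_ring_1 mat"
  assumes "length ds \<le> min k n" and Y: "Y \<in> carrier_mat n l" and ij: "i < k" "j < l"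
  shows "(smith_diag k n ds * Y) $$ (i, j) = (if i < length ds then of_nat (ds ! i) * Y $$ (i, j) else 0)"
proof -
  have "(smith_diag k n ds * Y) $$ (i, j) = (\<Sum>t<n. smith_diag k n ds $$ (i, t) * Y $$ (t, j))"
    using assms by (simp add: scalar_prod_def atLeast0LessThan smith_diag_def)
  also have "\<dots> = (\<Sum>t<n. if t = i then (if i < length ds then of_nat (ds ! i) * Y $$ (i, j) else 0) else 0)"
    using ij by (intro sum.cong) (auto simp: smith_diag_def)
  also have "\<dots> = (if i < length ds then of_nat (ds ! i) * Y $$ (i, j) else 0)"
    using assms(1) by simp
  finally show ?thesis .
qed

text \<open>Rows from \<open>length ds\<close> on are zero. On the other side, the padded divisor
  \<open>CARD('m)\<close> imposes a vacuous condition there, so \<open>i\<close> can range over all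
  of \<open>n\<close> whatever \<open>k\<close> is.\<close>

lemma smith_diag_mult_eq_0_iff:
  fixes Y :: "'m :: nontriv mod_ring mat"
  assumes len: "length ds \<le> min k n" and Y: "Y \<in> carrier_mat n l"
  shows "smith_diag k n ds * Y = 0\<^sub>m k l \<longleftrightarrow>
    (\<forall>i<n. \<forall>j<l. of_nat (padded_divisor CARD('m) ds i) * Y $$ (i, j) = 0)" (is "?L \<longleftrightarrow> ?R")
proof
  assume L: ?L
  show ?R
  proof (intro allI impI)
    fix i j assume "i < n" "j < l"
    show "of_nat (padded_divisor CARD('m) ds i) * Y $$ (i, j) = 0"
    proof (cases "i < length ds")
      case True
      then have "i < k" using len by simp
      then show ?thesis
        using smith_diag_mult_index[OF len Y \<open>i < k\<close> \<open>j < l\<close>] True \<open>j < l\<close>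
        by (simp add: L padded_divisor_def)
    qed (simp add: padded_divisor_def)
  qed
next
  assume R: ?R
  have "(smith_diag k n ds * Y) $$ (i, j) = 0" if "i < k" "j < l" for i j
  proof (cases "i < length ds")
    case True
    then have "i < n" using len by simp
    then have "of_nat (padded_divisor CARD('m) ds i) * Y $$ (i, j) = 0" using R that by blast
    then show ?thesis using True by (simp add: smith_diag_mult_index[OF len Y that] padded_divisor_def)
  qed (simp add: smith_diag_mult_index[OF len Y that])
  then show ?L using Y by (intro eq_matI) auto
qed

lemma invariant_divisorsE:
  fixes B :: "'m :: nontriv mod_ring mat"
  assumes "invariant_divisors B ds" and "B \<in> carrier_mat k n"
  obtains P P' Q Q' where
    "P \<in> carrier_mat k k" "P' \<in> carrier_mat k k" "P * P' = 1\<^sub>m k" "P' * P = 1\<^sub>m k"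
    "Q \<in> carrier_mat n n" "Q' \<in> carrier_mat n n" "Q * Q' = 1\<^sub>m n" "Q' * Q = 1\<^sub>m n"
    "P * B * Q = smith_diag k n ds"
proof -
  have dims: "dim_row B = k" "dim_col B = n" using assms(2) by auto
  obtain P Q where P: "P \<in> carrier_mat k k" "invertible_mat P"
    and Q: "Q \<in> carrier_mat n n" "invertible_mat Q"
    and PBQ: "P * B * Q = smith_diag k n ds"
    using assms(1) unfolding invariant_divisors_def dims smith_diag_def by blast
  show thesis using invertible_matE[OF P] invertible_matE[OF Q] that P(1) Q(1) PBQ by metis
qed

lemma invariant_divisors_length:
  assumes "invariant_divisors B ds" and "B \<in> carrier_mat k n"
  shows "length ds \<le> min k n"
  using assms by (auto simp: invariant_divisors_def)

lemma padded_divisor_dvd: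
  fixes B :: "'m :: nontriv mod_ring mat"
  assumes "invariant_divisors B ds"
  shows "padded_divisor CARD('m) ds i dvd CARD('m)"
  using assms by (auto simp: invariant_divisors_def padded_divisor_def)

section \<open>Counting matrices annihilated from both sides\<close>

text \<open>Matrices correspond to extensional functions on the index grid, so independent
  conditions on the entries give a product of counts.\<close>

lemma card_mat_entrywise:
  assumes "\<And>i j. i < n1 \<Longrightarrow> j < n2 \<Longrightarrow> card {y. R i j y} = c i j"
  shows "card {Y \<in> carrier_mat n1 n2. \<forall>i<n1. \<forall>j<n2. R i j (Y $$ (i, j))} = (\<Prod>i<n1. \<Prod>j<n2. c i j)"
proof -
  let ?I = "{..<n1} \<times> {..<n2}"
  have "bij_betw (\<lambda>f. mat n1 n2 f) (\<Pi>\<^sub>E p\<in>?I. {y. R (fst p) (snd p) y})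
          {Y \<in> carrier_mat n1 n2. \<forall>i<n1. \<forall>j<n2. R i j (Y $$ (i, j))}"
  proof (rule bij_betwI[where g = "\<lambda>Y. restrict (\<lambda>p. Y $$ p) ?I"], goal_cases)
    case 1
    show ?case by (force dest: PiE_mem)
  next
    case 2
    show ?case by (auto split: if_splits)
  next
    case (3 f)
    show ?case
    proof
      fix p
      show "restrict (\<lambda>p. mat n1 n2 f $$ p) ?I p = f p"
        using PiE_arb[OF 3, of p] by (cases p) auto
    qed
  next
    case (4 Y)
    then show ?case by (intro eq_matI) auto
  qed
  then have "card {Y \<in> carrier_mat n1 n2. \<forall>i<n1. \<forall>j<n2. R i j (Y $$ (i, j))} =
      card (\<Pi>\<^sub>E p\<in>?I. {y. R (fst p) (snd p) y})"
    by (rule bij_betw_same_card[symmetric])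
  also have "\<dots> = (\<Prod>p\<in>?I. c (fst p) (snd p))"
    using assms by (subst card_PiE) (auto intro!: prod.cong)
  finally show ?thesis by (simp add: prod.cartesian_product case_prod_beta)
qed

lemma card_two_sided_kernel:
  fixes B1 B2 :: "'m :: nontriv mod_ring mat"
  assumes B1: "B1 \<in> carrier_mat k1 n1" and B2: "B2 \<in> carrier_mat k2 n2"
    and ds1: "invariant_divisors B1 ds1" and ds2: "invariant_divisors B2 ds2"
  shows "card {X \<in> carrier_mat n1 n2. B1 * X = 0\<^sub>m k1 n2 \<and> B2 * X\<^sup>T = 0\<^sub>m k2 n1} =
    (\<Prod>i<n1. \<Prod>j<n2. gcd (padded_divisor CARD('m) ds1 i) (padded_divisor CARD('m) ds2 j))"
proof -
  obtain P1 P1' Q1 Q1' where 1: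
    "P1 \<in> carrier_mat k1 k1" "P1' \<in> carrier_mat k1 k1" "P1' * P1 = 1\<^sub>m k1"
    "Q1 \<in> carrier_mat n1 n1" "Q1' \<in> carrier_mat n1 n1" "Q1 * Q1' = 1\<^sub>m n1" "Q1' * Q1 = 1\<^sub>m n1"
    "P1 * B1 * Q1 = smith_diag k1 n1 ds1" using invariant_divisorsE[OF ds1 B1] by metis
  obtain P2 P2' Q2 Q2' where 2:
    "P2 \<in> carrier_mat k2 k2" "P2' \<in> carrier_mat k2 k2" "P2' * P2 = 1\<^sub>m k2"
    "Q2 \<in> carrier_mat n2 n2" "Q2' \<in> carrier_mat n2 n2" "Q2 * Q2' = 1\<^sub>m n2" "Q2' * Q2 = 1\<^sub>m n2"
    "P2 * B2 * Q2 = smith_diag k2 n2 ds2" using invariant_divisorsE[OF ds2 B2] by metis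
  have tr: "C\<^sup>T * A\<^sup>T = 1\<^sub>m n" if "A \<in> carrier_mat n n" "C \<in> carrier_mat n n" "A * C = 1\<^sub>m n"
    for A C :: "'m mod_ring mat" and n
    using transpose_mult[OF that(1,2)] that(3) by simp
  \<comment> \<open>The right-hand factors of the substitution are transposes, so inverses of the
    transposes are required as well.\<close>
  note 1 = 1 tr[OF 1(4-6)] tr[OF 1(5,4,7)] and 2 = 2 tr[OF 2(4-6)] tr[OF 2(5,4,7)]
  let ?K = "{X \<in> carrier_mat n1 n2. B1 * X = 0\<^sub>m k1 n2 \<and> B2 * X\<^sup>T = 0\<^sub>m k2 n1}"
  let ?\<delta>1 = "padded_divisor CARD('m) ds1" and ?\<delta>2 = "padded_divisor CARD('m) ds2"
  let ?L = "{Y :: 'm mod_ring mat. Y \<in> carrier_mat n1 n2 \<and> (\<forall>i<n1. \<forall>j<n2.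
     of_nat (?\<delta>1 i) * Y $$ (i, j) = 0 \<and> of_nat (?\<delta>2 j) * Y $$ (i, j) = 0)}"
  have key: "Q1 * Y * Q2\<^sup>T \<in> ?K \<longleftrightarrow> Y \<in> ?L" if Y: "Y \<in> carrier_mat n1 n2" for Y
  proof -
    \<comment> \<open>Transposing exchanges the roles of the two coordinate changes, so the second
      kernel condition has the same shape as the first.\<close>
    have T: "(Q1 * Y * Q2\<^sup>T)\<^sup>T = Q2 * Y\<^sup>T * Q1\<^sup>T"
      using 1 2 Y by (simp add: transpose_mult[of _ n1 n2 _ n2] transpose_mult[of _ n1 n1 _ n2]
        assoc_mult_mat[of _ n2 n2 _ n1 _ n1])
    have "B1 * (Q1 * Y * Q2\<^sup>T) = 0\<^sub>m k1 n2 \<longleftrightarrow> smith_diag k1 n1 ds1 * Y = 0\<^sub>m k1 n2"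
      using 1 2 B1 Y by (intro smith_mult_eq_0_iff) auto
    moreover have "B2 * (Q2 * Y\<^sup>T * Q1\<^sup>T) = 0\<^sub>m k2 n1 \<longleftrightarrow> smith_diag k2 n2 ds2 * Y\<^sup>T = 0\<^sub>m k2 n1"
      using 1 2 B2 Y by (intro smith_mult_eq_0_iff[where R' = "Q1'\<^sup>T"]) auto
    moreover have "Q1 * Y * Q2\<^sup>T \<in> carrier_mat n1 n2" using 1 2 Y by simp
    ultimately show ?thesis
      using Y smith_diag_mult_eq_0_iff[OF invariant_divisors_length[OF ds1 B1] Y]
        smith_diag_mult_eq_0_iff[OF invariant_divisors_length[OF ds2 B2], of "Y\<^sup>T" n1]
      by (auto simp: T)
  qed
  \<comment> \<open>Stated for arbitrary inverse pairs, since it serves both directions of the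
    bijection.\<close>
  have cancel: "A * (A' * Y * C) * C' = Y"
    if "A \<in> carrier_mat n1 n1" "A' \<in> carrier_mat n1 n1" "A * A' = 1\<^sub>m n1"
      "C \<in> carrier_mat n2 n2" "C' \<in> carrier_mat n2 n2" "C * C' = 1\<^sub>m n2" "Y \<in> carrier_mat n1 n2"
    for A A' C C' Y :: "'m mod_ring mat"
  proof -
    have "A * (A' * Y) = Y" using that by (simp flip: assoc_mult_mat[of A n1 n1 A' n1 Y n2])
    moreover have "A * (A' * Y * C) * C' = A * (A' * Y) * (C * C')"
      using that(1,2,4,5,7)
      by (simp add: assoc_mult_mat[of _ n1 n1 _ n2 _ n2] assoc_mult_mat[of _ n1 n2 _ n2 _ n2])
    ultimately show ?thesis using that by simp
  qed
  have bij: "bij_betw (\<lambda>Y. Q1 * Y * Q2\<^sup>T) ?L ?K"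
  proof (rule bij_betwI[where g = "\<lambda>X. Q1' * X * Q2'\<^sup>T"])
    show "(\<lambda>Y. Q1 * Y * Q2\<^sup>T) \<in> ?L \<rightarrow> ?K" using key by blast
    show "(\<lambda>X. Q1' * X * Q2'\<^sup>T) \<in> ?K \<rightarrow> ?L"
    proof
      fix X assume X: "X \<in> ?K"
      then have "Q1 * (Q1' * X * Q2'\<^sup>T) * Q2\<^sup>T = X" using 1 2 by (intro cancel) auto
      then show "Q1' * X * Q2'\<^sup>T \<in> ?L" using key[of "Q1' * X * Q2'\<^sup>T"] X 1 2 by auto
    qed
    show "Q1' * (Q1 * Y * Q2\<^sup>T) * Q2'\<^sup>T = Y" if "Y \<in> ?L" for Y
      using 1 2 that by (intro cancel) auto
    show "Q1 * (Q1' * X * Q2'\<^sup>T) * Q2\<^sup>T = X" if "X \<in> ?K" for X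
      using 1 2 that by (intro cancel) auto
  qed
  have "card ?K = card ?L" using bij_betw_same_card[OF bij] by (rule sym)
  also have "\<dots> = (\<Prod>i<n1. \<Prod>j<n2. gcd (?\<delta>1 i) (?\<delta>2 j))"
  proof (rule card_mat_entrywise)
    fix i j
    \<comment> \<open>The torsion count requires a divisor of \<open>CARD('m)\<close>; padded
      divisors are divisors too, so their gcd is one.\<close>
    have "gcd (?\<delta>1 i) (?\<delta>2 j) dvd CARD('m)"
      using padded_divisor_dvd[OF ds1] by (meson dvd_trans gcd_dvd1)
    then show "card {y :: 'm mod_ring. of_nat (?\<delta>1 i) * y = 0 \<and> of_nat (?\<delta>2 j) * y = 0} = gcd (?\<delta>1 i) (?\<delta>2 j)"
      unfolding gcd_torsion_iff by (rule card_torsion_mod_ring)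
  qed
  finally show ?thesis .
qed

section \<open>Stabilizers as kernel vectors\<close>

text \<open>The standard faithful additive character, which identifies residues with the
  \<open>CARD('m)\<close>-th roots of unity. It is computed on the least non-negative
  representative; \<open>root_char_of_nat\<close> shows that any natural representative gives the
  same value.\<close>

definition root_char :: "'m :: nontriv mod_ring \<Rightarrow> complex" where
  "root_char x = cis (2 * pi * of_int (to_int_mod_ring x) / of_nat CARD('m))"

lemma root_char_of_nat:
  "root_char (of_nat a :: 'm :: nontriv mod_ring) = cis (2 * pi * real a / real CARD('m))"
proof -
  let ?m = "CARD('m)"
  have "to_int_mod_ring (of_nat a :: 'm mod_ring) = int a mod int ?m"
    by transfer simp
  then have "root_char (of_nat a :: 'm mod_ring) = cis (2 * pi * real (a mod ?m) / real ?m)"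
    by (simp add: root_char_def flip: zmod_int)
  \<comment> \<open>The inserted factor is a full number of turns, hence 1; it turns the remainder
    back into \<open>a\<close>.\<close>
  also have "\<dots> = cis (2 * pi * real (a div ?m)) * cis (2 * pi * real (a mod ?m) / real ?m)"
    by (subst cis_multiple_2pi) auto
  also have "\<dots> = cis (2 * pi * (real (a div ?m) * real ?m + real (a mod ?m)) / real ?m)"
    unfolding cis_mult by (rule arg_cong[of _ _ cis]) (simp add: field_simps)
  also have "real (a div ?m) * real ?m + real (a mod ?m) = real a"
    by (simp flip: of_nat_mult of_nat_add)
  finally show ?thesis .
qed

lemma root_char_add: "root_char (x + y) = root_char x * root_char y"
proof -
  obtain a b where "x = of_nat a" "y = of_nat b" by (metis mod_ring_eq_of_nat)
  then show ?thesis
    using root_char_of_nat[where ?'m = 'a, of "a + b"]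
    by (simp add: root_char_of_nat cis_mult add_divide_distrib distrib_left)
qed

lemma root_char_0 [simp]: "root_char 0 = 1"
  using root_char_of_nat[of 0] by simp

lemma root_char_sum: "root_char (\<Sum>i\<in>A. f i) = (\<Prod>i\<in>A. root_char (f i))"
  by (induction A rule: infinite_finite_induct) (simp_all add: root_char_add)

text \<open>The representatives run through \<open>{..<CARD('m)}\<close>, which enumerates the roots
  of unity. Surjectivity later provides the logarithm of a stabilizer.\<close>

lemma bij_root_char: "bij_betw (root_char :: 'm :: nontriv mod_ring \<Rightarrow> complex) UNIV {z. z ^ CARD('m) = 1}"
proof -
  have "bij_betw (\<lambda>x :: 'm mod_ring. nat (to_int_mod_ring x)) UNIV {..<CARD('m)}"
  proof (rule bij_betwI[where g = of_nat], goal_cases)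
    case 1
    show ?case using to_int_mod_ring_bounds[where ?'m = 'm] by (auto simp: nat_less_iff)
  next
    case (3 x)
    have "to_int_mod_ring x \<ge> 0" by (rule to_int_mod_ring_bounds)
    then show ?case by (simp add: of_nat_of_int_mod_ring)
  next
    case (4 a)
    then show ?case by (simp add: of_nat_of_int_mod_ring)
  qed simp
  then have "bij_betw ((\<lambda>k. cis (2 * pi * real k / real CARD('m))) \<circ> (\<lambda>x :: 'm mod_ring. nat (to_int_mod_ring x)))
      UNIV {z. z ^ CARD('m) = 1}"
    by (rule bij_betw_trans) (rule bij_betw_roots_unity, simp)
  moreover have "(\<lambda>k. cis (2 * pi * real k / real CARD('m))) \<circ> (\<lambda>x :: 'm mod_ring. nat (to_int_mod_ring x)) = root_char"
  proof
    fix x :: "'m mod_ring"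
    have "to_int_mod_ring x \<ge> 0" by (rule to_int_mod_ring_bounds)
    then show "((\<lambda>k. cis (2 * pi * real k / real CARD('m))) \<circ> (\<lambda>x :: 'm mod_ring. nat (to_int_mod_ring x))) x = root_char x"
      by (simp add: root_char_def)
  qed
  ultimately show ?thesis by simp
qed

lemma root_char_power [simp]: "root_char (x :: 'm :: nontriv mod_ring) ^ CARD('m) = 1"
  using bij_betwE[OF bij_root_char[where ?'m = 'm]] by simp

lemma root_char_eq_iff [simp]: "root_char x = root_char y \<longleftrightarrow> x = y"
  by (rule inj_eq) (rule bij_betw_imp_inj_on[OF bij_root_char])

lemma root_char_eq_1_iff [simp]: "root_char x = 1 \<longleftrightarrow> x = 0"
  using root_char_eq_iff[of x 0] by simp

lemma root_char_nonzero [simp]: "root_char x \<noteq> 0"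
  by (simp add: root_char_def)

section \<open>The kernel of the incidence matrix\<close>

text \<open>The kernel of the incidence matrix, independent of any numbering of vertices and edges.
  Extensionality makes its cardinality count only values on \<open>V\<close>.\<close>

definition edge_kernel :: "'a set \<Rightarrow> 'a set set \<Rightarrow> ('a \<Rightarrow> 'r :: comm_ring_1) set" where
  "edge_kernel V E = {x \<in> V \<rightarrow>\<^sub>E UNIV. \<forall>e\<in>E. (\<Sum>v\<in>e. x v) = 0}"

text \<open>Adding a constant \<open>c\<close> changes an edge sum by \<open>CARD('m)\<close> times
  \<open>c\<close>, which is zero. Every kernel vector is therefore uniquely a constant plus a
  kernel vector vanishing at \<open>v0\<close>.\<close>

lemma card_edge_kernel_shift:
  assumes uni: "uniform_hypergraph CARD('m) V E" and v0: "v0 \<in> V"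
  shows "card (edge_kernel V E :: ('a \<Rightarrow> 'm :: nontriv mod_ring) set) =
    CARD('m) * card {x \<in> edge_kernel V E. x v0 = (0 :: 'm mod_ring)}"
proof -
  let ?K = "edge_kernel V E :: ('a \<Rightarrow> 'm mod_ring) set"
  have shift: "restrict (\<lambda>v. x v + c) V \<in> ?K" if "x \<in> ?K" for x c
  proof -
    have "(\<Sum>v\<in>e. restrict (\<lambda>v. x v + c) V v) = 0" if "e \<in> E" for e
    proof -
      have e: "e \<subseteq> V" "card e = CARD('m)" using uni \<open>e \<in> E\<close> by (auto simp: uniform_hypergraph_def)
      then have "(\<Sum>v\<in>e. restrict (\<lambda>v. x v + c) V v) = (\<Sum>v\<in>e. x v + c)"
        by (intro sum.cong) auto
      also have "\<dots> = 0" using \<open>x \<in> ?K\<close> \<open>e \<in> E\<close> e by (simp add: sum.distrib edge_kernel_def)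
      finally show ?thesis .
    qed
    then show ?thesis by (simp add: edge_kernel_def)
  qed
  have bij: "bij_betw (\<lambda>(c, x). restrict (\<lambda>v. x v + c) V) (UNIV \<times> {x \<in> ?K. x v0 = 0}) ?K"
  proof (rule bij_betwI[where g = "\<lambda>x. (x v0, restrict (\<lambda>v. x v + (- x v0)) V)"], goal_cases)
    case 1
    show ?case using shift by auto
  next
    case 2
    show ?case
    proof
      fix x assume "x \<in> ?K"
      then show "(x v0, restrict (\<lambda>v. x v + (- x v0)) V) \<in> UNIV \<times> {x \<in> ?K. x v0 = 0}"
        using shift[of x "- x v0"] v0 by simp
    qed
  next
    case (3 p)
    then show ?case using v0 by (cases p) (auto simp: edge_kernel_def fun_eq_iff PiE_def extensional_def)
  next
    case (4 x)
    then show ?case using v0 by (auto simp: edge_kernel_def fun_eq_iff PiE_def extensional_def)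
  qed
  show ?thesis using bij_betw_same_card[OF bij] by (simp add: card_cartesian_product)
qed

section \<open>From tensor equations to edge equations\<close>

lemma invertible_diagonal_mat_iff:
  fixes D :: "'a :: field mat"
  assumes D: "D \<in> carrier_mat n n" "diagonal_mat D"
  shows "invertible_mat D \<longleftrightarrow> (\<forall>i<n. D $$ (i, i) \<noteq> 0)"
proof -
  have idx: "(D * D') $$ (i, j) = D $$ (i, i) * D' $$ (i, j)"
    if "D' \<in> carrier_mat n n" "i < n" "j < n" for D' i j
  proof -
    have "(D * D') $$ (i, j) = (\<Sum>t<n. D $$ (i, t) * D' $$ (t, j))"
      using that D(1) by (simp add: scalar_prod_def atLeast0LessThan)
    also have "\<dots> = (\<Sum>t<n. if t = i then D $$ (i, i) * D' $$ (i, j) else 0)"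
      using that D by (intro sum.cong) (auto simp: diagonal_mat_def)
    finally show ?thesis using that by simp
  qed
  show ?thesis
  proof
    assume "invertible_mat D"
    then obtain D' where D': "D' \<in> carrier_mat n n" "D * D' = 1\<^sub>m n"
      using invertible_matE[OF D(1)] by metis
    show "\<forall>i<n. D $$ (i, i) \<noteq> 0"
    proof (intro allI impI)
      fix i assume "i < n"
      then show "D $$ (i, i) \<noteq> 0" using idx[OF D'(1), of i i] D'(2) by auto
    qed
  next
    assume nz: "\<forall>i<n. D $$ (i, i) \<noteq> 0"
    define D' where "D' = mat n n (\<lambda>(i, j). if i = j then inverse (D $$ (i, i)) else 0)"
    have D': "D' \<in> carrier_mat n n" by (simp add: D'_def)
    have r: "D * D' = 1\<^sub>m n"
    proof (intro eq_matI)
      fix i j assume "i < dim_row (1\<^sub>m n)" "j < dim_col (1\<^sub>m n)"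
      then show "(D * D') $$ (i, j) = 1\<^sub>m n $$ (i, j)"
        using nz by (simp add: idx[OF D']) (simp add: D'_def)
    qed (use D(1) D' in auto)
    moreover have "D' * D = 1\<^sub>m n" using mat_mult_left_right_inverse[OF D(1) D' r] .
    ultimately show "invertible_mat D"
      using D(1) D' unfolding invertible_mat_def inverts_mat_def by auto
  qed
qed

lemma bij_betw_nth_enumerates:
  "enumerates vs V \<Longrightarrow> bij_betw ((!) vs) {..<length vs} V"
  by (auto simp: enumerates_def intro!: bij_betw_nth)

text \<open>Zero entries of the tensor impose nothing. At a nonzero entry the common value cancels,
  and multiplying by the \<open>m\<close>-th power of the head's diagonal entry leaves an equation
  between the edge product and that power.\<close>

lemma tensor_condition_iff:
  fixes z :: "'a \<Rightarrow> complex"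
  assumes uni: "uniform_hypergraph m V E" and m: "m > 0" and vs: "enumerates vs V"
    and z: "\<And>i. i < length vs \<Longrightarrow> z (vs ! i) = D $$ (i, i)"
    and nz: "\<And>v. v \<in> V \<Longrightarrow> z v \<noteq> 0"
  shows "(\<forall>is. length is = m \<and> set is \<subseteq> {..<length vs} \<longrightarrow>
      inverse (D $$ (hd is, hd is) ^ (m - 1)) * adjacency_tensor m vs E is * (\<Prod>i\<leftarrow>tl is. D $$ (i, i))
        = adjacency_tensor m vs E is)
    \<longleftrightarrow> (\<forall>e\<in>E. \<forall>v\<in>e. (\<Prod>u\<in>e. z u) = z v ^ m)" (is "(\<forall>is. ?P is \<longrightarrow> ?Q is) \<longleftrightarrow> ?R")
proof -
  have inV: "vs ! i \<in> V" if "i < length vs" for i using vs that by (auto simp: enumerates_def)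
  have main: "?Q is \<longleftrightarrow> (\<Prod>u\<in>e. z u) = z (vs ! hd is) ^ m"
    if "is": "?P is" and e: "e = (!) vs ` set is" "e \<in> E" for "is" e
  proof -
    have "is \<noteq> []" using "is" m by auto
    then obtain h t where ht: "is = h # t" by (cases "is") auto
    \<comment> \<open>An index list of length \<open>m\<close> whose image is an edge with
      \<open>m\<close> vertices has no repetitions, so the edge product is the product along the
      list.\<close>
    have "card (set (map ((!) vs) is)) = length (map ((!) vs) is)"
      using uni e "is" by (auto simp: uniform_hypergraph_def)
    then have "distinct (map ((!) vs) is)" by (rule card_distinct)
    then have "(\<Prod>u\<in>e. z u) = prod_list (map z (map ((!) vs) is))"
      unfolding e by (subst prod.distinct_set_conv_list[symmetric]) simp_all
    also have "map z (map ((!) vs) is) = map (\<lambda>i. D $$ (i, i)) is"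
      using "is" z by auto
    finally have p: "(\<Prod>u\<in>e. z u) = D $$ (h, h) * (\<Prod>i\<leftarrow>t. D $$ (i, i))" by (simp add: ht)
    have h: "z (vs ! h) = D $$ (h, h)" "D $$ (h, h) \<noteq> 0"
      using "is" z[of h] nz[OF inV[of h]] by (auto simp: ht)
    have "z (vs ! hd is) ^ m = D $$ (h, h) * D $$ (h, h) ^ (m - 1)"
      using m by (cases m) (simp_all add: ht h)
    then have "(\<Prod>u\<in>e. z u) = z (vs ! hd is) ^ m \<longleftrightarrow> (\<Prod>i\<leftarrow>t. D $$ (i, i)) = D $$ (h, h) ^ (m - 1)"
      using h by (simp add: p)
    moreover have "adjacency_tensor m vs E is = 1 / fact (m - 1)"
      using e by (simp add: adjacency_tensor_def)
    ultimately show ?thesis using h by (auto simp: ht divide_simps)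
  qed
  show ?thesis
  proof
    assume L: "\<forall>is. ?P is \<longrightarrow> ?Q is"
    show ?R
    proof (intro ballI)
      fix e v assume ev: "e \<in> E" "v \<in> e"
      then have e: "e \<subseteq> V" "card e = m" using uni by (auto simp: uniform_hypergraph_def)
      then have "finite e" using m card_ge_0_finite by blast
      \<comment> \<open>The head index plays a special role in the tensor equation, so the edge is
        listed with \<open>v\<close> first.\<close>
      then obtain us where us: "set us = e - {v}" "distinct us"
        using finite_distinct_list[of "e - {v}"] by auto
      define g where "g = inv_into {..<length vs} ((!) vs)"
      have g: "g u < length vs" "vs ! g u = u" if "u \<in> V" for u
        using bij_betw_nth_enumerates[OF vs] that
        by (auto simp: g_def bij_betw_def f_inv_into_f inv_into_into simp flip: lessThan_iff)
      let ?is = "map g (v # us)"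
      have "length us = card (e - {v})" using us distinct_card by metis
      then have "length ?is = m" using e ev \<open>finite e\<close> m by (simp add: card_Diff_singleton)
      moreover have "v \<in> V" "set us \<subseteq> V" using us e ev by auto
      ultimately have P: "?P ?is" using g by (auto simp: subset_iff)
      have "map ((!) vs \<circ> g) (v # us) = v # us"
        using \<open>v \<in> V\<close> \<open>set us \<subseteq> V\<close> g(2) by (intro map_idI) auto
      then have "(!) vs ` set ?is = set (v # us)" by (metis map_map set_map)
      also have "\<dots> = e" using us ev by auto
      finally have e_eq: "e = (!) vs ` set ?is" by (rule sym)
      have "(\<Prod>u\<in>e. z u) = z (vs ! hd ?is) ^ m"
        using mp[OF spec[OF L] P] by (rule iffD1[OF main[OF P e_eq ev(1)]])
      then show "(\<Prod>u\<in>e. z u) = z v ^ m" by (simp add: g(2)[OF \<open>v \<in> V\<close>])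
    qed
  next
    assume R: ?R
    show "\<forall>is. ?P is \<longrightarrow> ?Q is"
    proof (intro allI impI)
      fix "is" assume P: "?P is"
      show "?Q is"
      proof (cases "(!) vs ` set is \<in> E")
        case True
        have "vs ! hd is \<in> (!) vs ` set is" using P m by (cases "is") auto
        then have "(\<Prod>u\<in>(!) vs ` set is. z u) = z (vs ! hd is) ^ m" using R True by blast
        then show ?thesis by (rule iffD2[OF main[OF P refl True]])
      qed (simp add: adjacency_tensor_def)
    qed
  qed
qed

text \<open>Connectedness only enters through the second hypothesis, which is easier to transfer to Cartesian
  products than the existence of walks.\<close>

lemma stabilizing_index_eq_card_edge_kernel:
  assumes uni: "uniform_hypergraph CARD('m) V E"
    and conn: "\<And>f :: 'a \<Rightarrow> complex. (\<And>e u v. e \<in> E \<Longrightarrow> u \<in> e \<Longrightarrow> v \<in> e \<Longrightarrow> f u = f v) \<Longrightarrow>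
      (\<And>u v. u \<in> V \<Longrightarrow> v \<in> V \<Longrightarrow> f u = f v)"
    and vs: "enumerates vs V"
  shows "CARD('m) * stabilizing_index CARD('m) vs E = card (edge_kernel V E :: ('a \<Rightarrow> 'm :: nontriv mod_ring) set)"
proof -
  let ?m = "CARD('m)" and ?n = "length vs"
  let ?K = "{x \<in> edge_kernel V E. x (vs ! 0) = (0 :: 'm mod_ring)}"
  let ?S = "tensor_stabilizers ?m ?n (adjacency_tensor ?m vs E)"
  define M where "M x = mat ?n ?n (\<lambda>(i, j). if i = j then root_char (x (vs ! i) :: 'm mod_ring) else 0)" for x
  have n: "?n > 0" using uni vs by (auto simp: uniform_hypergraph_def enumerates_def)
  have inV: "vs ! i \<in> V" if "i < ?n" for i using vs that by (auto simp: enumerates_def)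
  have sub: "e \<subseteq> V" if "e \<in> E" for e using uni that by (auto simp: uniform_hypergraph_def)
  have M: "M x \<in> carrier_mat ?n ?n" "diagonal_mat (M x)" "\<And>i. i < ?n \<Longrightarrow> M x $$ (i, i) = root_char (x (vs ! i))" for x
    by (auto simp: M_def diagonal_mat_def)
  have "bij_betw M ?K ?S"
    unfolding bij_betw_def
  proof (intro conjI inj_onI equalityI subsetI)
    fix x y assume xy: "x \<in> ?K" "y \<in> ?K" "M x = M y"
    have "x v = y v" for v
    proof (cases "v \<in> V")
      case True
      then obtain i where i: "i < ?n" "v = vs ! i"
        using vs by (auto simp: enumerates_def in_set_conv_nth)
      then show ?thesis using M(3)[of i x] M(3)[of i y] xy(3) by simp
    next
      case False
      then show ?thesis using xy by (auto simp: edge_kernel_def dest!: PiE_arb)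
    qed
    then show "x = y" by blast
  next
    fix D assume "D \<in> M ` ?K"
    then obtain x where x: "x \<in> ?K" "D = M x" by blast
    have "invertible_mat D"
      using invertible_diagonal_mat_iff[OF M(1,2), of x] x(2) M(3)[of _ x] by simp
    moreover have "D $$ (0, 0) = 1" using x M(3)[OF n, of x] by simp
    \<comment> \<open>Both sides equal 1: the left is the character of a vanishing edge sum, the
      right a power of a root of unity.\<close>
    moreover have "(\<Prod>u\<in>e. root_char (x u)) = root_char (x v) ^ ?m" if "e \<in> E" "v \<in> e" for e v
      using x that by (simp add: edge_kernel_def flip: root_char_sum)
    ultimately show "D \<in> ?S"
      unfolding tensor_stabilizers_def x(2)
      using tensor_condition_iff[OF uni _ vs, of "\<lambda>v. root_char (x v)" "M x"] M by simp
  next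
    fix D assume D: "D \<in> ?S"
    then have D0: "D \<in> carrier_mat ?n ?n" "diagonal_mat D" "D $$ (0, 0) = 1"
      and nz: "\<And>i. i < ?n \<Longrightarrow> D $$ (i, i) \<noteq> 0"
      using invertible_diagonal_mat_iff[of D ?n] by (auto simp: tensor_stabilizers_def)
    define g where "g = inv_into {..<?n} ((!) vs)"
    define z where "z v = D $$ (g v, g v)" for v
    have g: "g (vs ! i) = i" if "i < ?n" for i
      using bij_betw_nth_enumerates[OF vs] that by (auto simp: g_def bij_betw_def)
    have z: "z (vs ! i) = D $$ (i, i)" if "i < ?n" for i using g[OF that] by (simp add: z_def)
    have nz': "z v \<noteq> 0" if "v \<in> V" for v
      using that vs z nz by (auto simp: enumerates_def in_set_conv_nth)
    have R: "(\<Prod>u\<in>e. z u) = z v ^ ?m" if "e \<in> E" "v \<in> e" for e v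
      using tensor_condition_iff[OF uni _ vs, of z D] z nz' D that
      unfolding tensor_stabilizers_def by simp
    \<comment> \<open>By \<open>R\<close> the power at any vertex of an edge is the edge product, so
      the power is constant on edges and \<open>conn\<close> applies.\<close>
    have "z u ^ ?m = z v ^ ?m" if "u \<in> V" "v \<in> V" for u v
    proof (rule conn[OF _ that, of "\<lambda>v. z v ^ ?m"])
      fix e u v assume "e \<in> E" "u \<in> e" "v \<in> e"
      then show "z u ^ ?m = z v ^ ?m" using R[of e u] R[of e v] by simp
    qed
    from this[OF _ inV[OF n]] have pow: "z v ^ ?m = 1" if "v \<in> V" for v
      using that z[OF n] D0(3) by simp
    \<comment> \<open>The logarithm of \<open>z\<close>, made extensional so that it can lie in
      \<open>edge_kernel\<close>.\<close>
    define x where "x = restrict (\<lambda>v. inv_into UNIV (root_char :: 'm mod_ring \<Rightarrow> complex) (z v)) V"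
    have x: "root_char (x v) = z v" if "v \<in> V" for v
    proof -
      have "z v \<in> range (root_char :: 'm mod_ring \<Rightarrow> complex)"
        using pow[OF that] bij_root_char[where ?'m = 'm] by (auto simp: bij_betw_def)
      then show ?thesis using that by (simp add: x_def f_inv_into_f)
    qed
    have "(\<Sum>v\<in>e. x v) = 0" if "e \<in> E" for e
    proof (cases "e = {}")
      case False
      then obtain v where "v \<in> e" by blast
      have "root_char (\<Sum>v\<in>e. x v) = (\<Prod>u\<in>e. z u)"
        unfolding root_char_sum using sub[OF that] x by (intro prod.cong) auto
      also have "\<dots> = 1" using R[OF that \<open>v \<in> e\<close>] pow sub[OF that] \<open>v \<in> e\<close> by auto
      finally show ?thesis by simp
    qed simp
    moreover have "root_char (x (vs ! 0)) = 1" using x[OF inV[OF n]] z[OF n] D0(3) by simp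
    ultimately have "x \<in> ?K" by (simp add: edge_kernel_def x_def)
    moreover have "D = M x"
      using D0 x inV z by (intro eq_matI) (auto simp: M_def diagonal_mat_def)
    ultimately show "D \<in> M ` ?K" by blast
  qed
  then have "card ?K = card ?S" by (rule bij_betw_same_card)
  then show ?thesis
    using card_edge_kernel_shift[OF uni inV[OF n]] by (simp add: stabilizing_index_def)
qed

section \<open>Connectedness and uniformity of Cartesian products\<close>

text \<open>Consecutive vertices of a walk share an edge, so the value of \<open>f\<close>
  propagates along the walk.\<close>

lemma connected_edgewise_constant:
  assumes conn: "hypergraph_connected V E"
    and f: "\<And>e u v. e \<in> E \<Longrightarrow> u \<in> e \<Longrightarrow> v \<in> e \<Longrightarrow> f u = f v"
    and uv: "u \<in> V" "v \<in> V"
  shows "f u = f v"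
proof -
  obtain ws es where w: "hypergraph_walk E ws es" "hd ws = u" "last ws = v"
    using conn uv unfolding hypergraph_connected_def by blast
  then have len: "length ws = Suc (length es)"
    and step: "\<And>i. i < length es \<Longrightarrow> es ! i \<in> E \<and> {ws ! i, ws ! Suc i} \<subseteq> es ! i"
    by (auto simp: hypergraph_walk_def)
  have const: "f (ws ! i) = f (ws ! 0)" if "i \<le> length es" for i
    using that
  proof (induction i)
    case (Suc i)
    then have "f (ws ! Suc i) = f (ws ! i)" using step[of i] by (intro f[of "es ! i"]) auto
    then show ?case using Suc by simp
  qed simp
  have "ws \<noteq> []" using len by auto
  then have "hd ws = ws ! 0" "last ws = ws ! length es"
    by (simp_all add: hd_conv_nth last_conv_nth len)
  then show ?thesis using const[OF order_refl] w(2,3) by simp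
qed

text \<open>First the left coordinate is changed inside a copy of the first hypergraph, then the
  right one inside a copy of the second.\<close>

lemma cartesian_edgewise_constant:
  assumes conn: "hypergraph_connected V E" "hypergraph_connected W F"
    and f: "\<And>e p q. e \<in> cartesian_edges V E W F \<Longrightarrow> p \<in> e \<Longrightarrow> q \<in> e \<Longrightarrow> f p = f q"
    and pq: "p \<in> V \<times> W" "q \<in> V \<times> W"
  shows "f p = f q"
proof -
  obtain i j k l where ij: "p = (i, j)" "q = (k, l)" "i \<in> V" "j \<in> W" "k \<in> V" "l \<in> W" using pq by auto
  have "f (i, j) = f (k, j)"
  proof (rule connected_edgewise_constant[OF conn(1) _ ij(3,5), of "\<lambda>i. f (i, j)"])
    fix e u v assume "e \<in> E" "u \<in> e" "v \<in> e"
    then show "f (u, j) = f (v, j)"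
      using ij by (intro f[of "e \<times> {j}"]) (auto simp: cartesian_edges_def)
  qed
  also have "\<dots> = f (k, l)"
  proof (rule connected_edgewise_constant[OF conn(2) _ ij(4,6), of "\<lambda>j. f (k, j)"])
    fix e u v assume "e \<in> F" "u \<in> e" "v \<in> e"
    then show "f (k, u) = f (k, v)"
      using ij by (intro f[of "{k} \<times> e"]) (auto simp: cartesian_edges_def)
  qed
  finally show ?thesis using ij by simp
qed

lemma uniform_cartesian:
  assumes "uniform_hypergraph m V E" "uniform_hypergraph m W F"
  shows "uniform_hypergraph m (V \<times> W) (cartesian_edges V E W F)"
  unfolding uniform_hypergraph_def
proof (intro conjI ballI)
  fix e assume "e \<in> cartesian_edges V E W F"
  then consider i f where "e = {i} \<times> f" "i \<in> V" "f \<in> F" | f j where "e = f \<times> {j}" "f \<in> E" "j \<in> W"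
    unfolding cartesian_edges_def by blast
  then show "e \<subseteq> V \<times> W" "card e = m"
    using assms by (cases; force simp: uniform_hypergraph_def card_cartesian_product)+
qed (use assms in \<open>auto simp: uniform_hypergraph_def\<close>)

section \<open>Rank over a prime field\<close>

text \<open>Coordinates with respect to a finite basis identify the space with the extensional
  functions from the basis to the field.\<close>

lemma (in vectorspace) card_carrier_eq:
  assumes "finite (carrier K)" "finite (carrier V)"
  shows "card (carrier V) = card (carrier K) ^ dim"
proof -
  \<comment> \<open>A finite carrier is a finite generating set of itself, so a finite basis
    exists.\<close>
  have "span (carrier V) = carrier V"
    using in_own_span[of "carrier V"] span_is_subset2[of "carrier V"] by blast
  then have "fin_dim" using assms(2) unfolding fin_dim_def by blast
  then obtain \<beta> where \<beta>: "finite \<beta>" "basis \<beta>" using finite_basis_exists by blast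
  then have sub: "\<beta> \<subseteq> carrier V" by (simp add: basis_def)
  have ex1: "\<exists>!a. a \<in> \<beta> \<rightarrow>\<^sub>E carrier K \<and> lincomb a \<beta> = v" if "v \<in> carrier V" for v
    using basis_criterion[OF \<beta>(1) sub] \<beta>(2) that by blast
  have closed: "lincomb a \<beta> \<in> carrier V" if "a \<in> \<beta> \<rightarrow>\<^sub>E carrier K" for a
    using that by (intro lincomb_closed[OF sub]) (auto simp: PiE_def)
  have "bij_betw (\<lambda>a. lincomb a \<beta>) (\<beta> \<rightarrow>\<^sub>E carrier K) (carrier V)"
    unfolding bij_betw_def
  proof (intro conjI inj_onI equalityI subsetI)
    fix a b assume "a \<in> \<beta> \<rightarrow>\<^sub>E carrier K" "b \<in> \<beta> \<rightarrow>\<^sub>E carrier K" "lincomb a \<beta> = lincomb b \<beta>"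
    then show "a = b" using ex1[OF closed] by blast
  next
    fix v assume "v \<in> carrier V"
    then show "v \<in> (\<lambda>a. lincomb a \<beta>) ` (\<beta> \<rightarrow>\<^sub>E carrier K)" using ex1 by blast
  qed (use closed in blast)
  then have "card (\<beta> \<rightarrow>\<^sub>E carrier K) = card (carrier V)" by (rule bij_betw_same_card)
  then show ?thesis using dim_basis[OF \<beta>] \<beta>(1) by (simp add: card_PiE)
qed

text \<open>Primality is a hypothesis rather than a type class, so the field structure is
  established for the ring record; inverses come from Bezout.\<close>

lemma field_class_ring_mod_ring:
  assumes "prime CARD('m :: nontriv)"
  shows "field (class_ring :: 'm mod_ring ring)"
proof -
  have "cring (class_ring :: 'm mod_ring ring)" by (rule class_cring.cring_axioms)
  then show ?thesis
  proof (rule cring.cring_fieldI2)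
    fix x :: "'m mod_ring" assume "x \<noteq> \<zero>\<^bsub>class_ring\<^esub>"
    then have "x \<noteq> 0" by simp
    obtain a where a: "x = of_nat a" by (rule mod_ring_eq_of_nat)
    then have "\<not> CARD('m) dvd a" using \<open>x \<noteq> 0\<close> of_nat_mod_ring_eq_0_iff by blast
    then have "gcd a CARD('m) = 1"
      using assms by (metis coprime_commute coprime_iff_gcd_eq_1 prime_imp_coprime)
    then obtain u v where "u * int a + v * int CARD('m) = 1"
      using bezout_int[of "int a" "int CARD('m)"] by auto
    then have "of_int (u * int a + v * int CARD('m)) = (1 :: 'm mod_ring)" by simp
    then have "x * of_int u = 1" by (simp add: a mult.commute)
    then show "\<exists>y\<in>carrier class_ring. x \<otimes>\<^bsub>class_ring\<^esub> y = \<one>\<^bsub>class_ring\<^esub>" by auto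
  qed simp
qed

lemma module_module_vec: "Module.module class_ring (module_vec TYPE('a :: comm_ring_1) k)"
proof -
  interpret vec_module "TYPE('a)" k .
  show ?thesis by (rule module_axioms)
qed

text \<open>The range is a submodule containing each column as the image of a unit vector;
  conversely \<open>B *\<^sub>v x\<close> is the combination of the columns with coefficients
  \<open>x\<close>.\<close>

lemma span_cols_eq_range:
  fixes B :: "'a :: comm_ring_1 mat"
  assumes B: "B \<in> carrier_mat k n"
  shows "LinearCombinations.module.span class_ring (module_vec TYPE('a) k) (set (cols B)) =
    (\<lambda>x. B *\<^sub>v x) ` carrier_vec n"
proof -
  interpret vec_module "TYPE('a)" k .
  have colsB: "set (cols B) \<subseteq> carrier_vec k" using B cols_dim by blast
  show ?thesis
  proof (intro equalityI)
    have "submodule class_ring ((\<lambda>x. B *\<^sub>v x) ` carrier_vec n) V"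
    proof (rule submodule.intro[OF module_module_vec], goal_cases)
      case 1
      show ?case using B by (auto simp: module_vec_simps)
    next
      case (2 v w)
      then obtain x y where "v = B *\<^sub>v x" "w = B *\<^sub>v y" "x \<in> carrier_vec n" "y \<in> carrier_vec n" by blast
      then show ?case using B
        by (auto simp: module_vec_simps simp flip: mult_add_distrib_mat_vec[OF B])
    next
      case 3
      have "B *\<^sub>v 0\<^sub>v n = 0\<^sub>v k" using B by auto
      then have "0\<^sub>v k \<in> (\<lambda>x. B *\<^sub>v x) ` carrier_vec n" by (metis imageI zero_carrier_vec)
      then show ?case by (simp add: module_vec_simps)
    next
      case (4 c v)
      then obtain x where "v = B *\<^sub>v x" "x \<in> carrier_vec n" by blast
      moreover from this have "c \<cdot>\<^sub>v (B *\<^sub>v x) = B *\<^sub>v (c \<cdot>\<^sub>v x)"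
        using B by (intro eq_vecI) auto
      ultimately show ?case by (auto simp: module_vec_simps)
    qed
    moreover have "set (cols B) \<subseteq> (\<lambda>x. B *\<^sub>v x) ` carrier_vec n"
    proof
      fix c assume "c \<in> set (cols B)"
      then obtain j where j: "j < n" "c = col B j" using B by (auto simp: cols_def)
      then have "c = B *\<^sub>v unit_vec n j"
        using B by (intro eq_vecI) (auto simp: scalar_prod_right_unit)
      then show "c \<in> (\<lambda>x. B *\<^sub>v x) ` carrier_vec n" by auto
    qed
    ultimately show "span (set (cols B)) \<subseteq> (\<lambda>x. B *\<^sub>v x) ` carrier_vec n"
      by (intro span_is_subset) auto
    show "(\<lambda>x. B *\<^sub>v x) ` carrier_vec n \<subseteq> span (set (cols B))"
    proof
      fix v assume "v \<in> (\<lambda>x. B *\<^sub>v x) ` carrier_vec n"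
      then obtain x where x: "v = B *\<^sub>v x" "x \<in> carrier_vec n" by blast
      have "mat_of_cols k (cols B) = B" using B mat_of_cols_cols[of B] by simp
      \<comment> \<open>The linear combination runs over the set of columns, so coefficients of
        repeated columns are added up.\<close>
      moreover have "mat_of_cols k (cols B) *\<^sub>v x =
          lincomb (\<lambda>l. \<Sum>i = 0..<length (cols B). if l = cols B ! i then x $ i else 0) (set (cols B))"
        using x B colsB by (intro mat_of_cols_mult_as_finsum) auto
      ultimately show "v \<in> span (set (cols B))"
        unfolding span_def using x(1) by auto
    qed
  qed
qed

lemma card_vec_entrywise:
  assumes "\<And>i. i < n \<Longrightarrow> card {y. R i y} = c i"
  shows "card {w \<in> carrier_vec n. \<forall>i<n. R i (w $ i)} = (\<Prod>i<n. c i)"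
proof -
  have bij: "bij_betw (\<lambda>f. vec n f) (\<Pi>\<^sub>E i\<in>{..<n}. {y. R i y}) {w \<in> carrier_vec n. \<forall>i<n. R i (w $ i)}"
  proof (rule bij_betwI[where g = "\<lambda>w. restrict (\<lambda>i. w $ i) {..<n}"], goal_cases)
    case 1
    show ?case by (force dest: PiE_mem)
  next
    case 2
    show ?case by (auto split: if_splits)
  next
    case (3 f)
    show ?case
    proof
      fix i
      show "restrict (\<lambda>i. vec n f $ i) {..<n} i = f i" using PiE_arb[OF 3, of i] by auto
    qed
  next
    case (4 w)
    then show ?case by (intro eq_vecI) auto
  qed
  show ?thesis using bij_betw_same_card[OF bij] assms by (simp add: card_PiE)
qed

lemma smith_diag_mult_vec_index:
  fixes y :: "'a :: comm_ring_1 vec"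
  assumes "length ds \<le> min k n" and y: "y \<in> carrier_vec n" and i: "i < k"
  shows "(smith_diag k n ds *\<^sub>v y) $ i = (if i < length ds then of_nat (ds ! i) * y $ i else 0)"
proof -
  have "(smith_diag k n ds *\<^sub>v y) $ i = (\<Sum>t<n. smith_diag k n ds $$ (i, t) * y $ t)"
    using assms by (simp add: scalar_prod_def atLeast0LessThan smith_diag_def)
  also have "\<dots> = (\<Sum>t<n. if t = i then (if i < length ds then of_nat (ds ! i) * y $ i else 0) else 0)"
    using i by (intro sum.cong) (auto simp: smith_diag_def)
  also have "\<dots> = (if i < length ds then of_nat (ds ! i) * y $ i else 0)"
    using assms(1) by simp
  finally show ?thesis .
qed

text \<open>When all divisors are 1, \<open>P\<close> maps the range of \<open>B\<close> bijectively
  onto the vectors supported on the first \<open>length ds\<close> coordinates.\<close>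

lemma card_range_mult_mat_vec:
  fixes B :: "'m :: nontriv mod_ring mat"
  assumes B: "B \<in> carrier_mat k n" and ds: "invariant_divisors B ds"
    and one: "\<And>i. i < length ds \<Longrightarrow> ds ! i = 1"
  shows "card ((\<lambda>x. B *\<^sub>v x) ` carrier_vec n) = CARD('m) ^ length ds"
proof -
  let ?r = "length ds" and ?D = "smith_diag k n ds :: 'm mod_ring mat"
  have len: "?r \<le> min k n" by (rule invariant_divisors_length[OF ds B])
  obtain P P' Q Q' where
    P: "P \<in> carrier_mat k k" "P' \<in> carrier_mat k k" "P' * P = 1\<^sub>m k" and
    Q: "Q \<in> carrier_mat n n" "Q' \<in> carrier_mat n n" "Q * Q' = 1\<^sub>m n"
    and PBQ: "P * B * Q = ?D" using invariant_divisorsE[OF ds B] by metis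
  let ?im = "(\<lambda>x. B *\<^sub>v x) ` carrier_vec n"
  let ?W = "{w \<in> carrier_vec k. \<forall>i<k. ?r \<le> i \<longrightarrow> w $ i = (0 :: 'm mod_ring)}"
  have PB: "P *\<^sub>v (B *\<^sub>v (Q *\<^sub>v y)) = ?D *\<^sub>v y" if "y \<in> carrier_vec n" for y
    using that P B Q unfolding PBQ[symmetric]
    by (simp add: assoc_mult_mat_vec[of _ k n _ n] assoc_mult_mat_vec[of _ k k _ n])
  have Dy: "?D *\<^sub>v y = vec k (\<lambda>i. if i < ?r then y $ i else 0)" if "y \<in> carrier_vec n" for y
    using smith_diag_mult_vec_index[OF len that] one by (intro eq_vecI) auto
  have "(\<lambda>v. P *\<^sub>v v) ` ?im = ?W"
  proof (intro equalityI subsetI)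
    fix w assume "w \<in> (\<lambda>v. P *\<^sub>v v) ` ?im"
    then obtain x where x: "x \<in> carrier_vec n" "w = P *\<^sub>v (B *\<^sub>v x)" by blast
    have "x = Q *\<^sub>v (Q' *\<^sub>v x)" using x Q by (simp flip: assoc_mult_mat_vec[of _ n n _ n])
    then have "w = ?D *\<^sub>v (Q' *\<^sub>v x)" using PB[of "Q' *\<^sub>v x"] x Q by auto
    then show "w \<in> ?W" using Dy[of "Q' *\<^sub>v x"] x Q by auto
  next
    fix w assume w: "w \<in> ?W"
    \<comment> \<open>The preimage copies the possibly nonzero coordinates of \<open>w\<close> into
      a vector of length \<open>n\<close>; this fits because \<open>?r\<close> is at most
      \<open>min k n\<close>.\<close>
    define y where "y = vec n (\<lambda>i. if i < ?r then w $ i else 0)"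
    have y: "y \<in> carrier_vec n" by (simp add: y_def)
    have "w = ?D *\<^sub>v y" unfolding Dy[OF y] using w len by (intro eq_vecI) (auto simp: y_def)
    then have "w = P *\<^sub>v (B *\<^sub>v (Q *\<^sub>v y))" using PB[OF y] by simp
    moreover have "Q *\<^sub>v y \<in> carrier_vec n" by (rule mult_mat_vec_carrier[OF Q(1) y])
    ultimately show "w \<in> (\<lambda>v. P *\<^sub>v v) ` ?im" by blast
  qed
  moreover have "inj_on (\<lambda>v. P *\<^sub>v v) ?im"
  proof (rule inj_on_inverseI[where g = "\<lambda>v. P' *\<^sub>v v"])
    fix v assume "v \<in> ?im"
    then have "v \<in> carrier_vec k" using B by auto
    then show "P' *\<^sub>v (P *\<^sub>v v) = v" using P by (simp flip: assoc_mult_mat_vec[of _ k k _ k])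
  qed
  ultimately have "card ?im = card ?W" by (metis card_image)
  also have "\<dots> = (\<Prod>i<k. if i < ?r then CARD('m) else 1)"
    by (rule card_vec_entrywise) auto
  also have "\<dots> = (\<Prod>i<?r. CARD('m))"
    using len by (intro prod.mono_neutral_cong_right) auto
  finally show ?thesis by simp
qed

lemma prime_invariant_divisors_eq_1:
  fixes B :: "'m :: nontriv mod_ring mat"
  assumes "invariant_divisors B ds" "prime CARD('m)" "i < length ds"
  shows "ds ! i = 1"
proof -
  have dvd: "ds ! i dvd CARD('m)" and le: "ds ! i \<le> CARD('m) - 1"
    using assms(1,3) unfolding invariant_divisors_def by blast+
  have "ds ! i < CARD('m)" using le nontriv[where ?'a = 'm] by linarith
  then have "ds ! i \<noteq> CARD('m)" by (rule less_imp_neq)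
  moreover have "\<forall>d. d dvd CARD('m) \<longrightarrow> d = 1 \<or> d = CARD('m)"
    using assms(2) unfolding prime_nat_iff by (rule conjunct2)
  ultimately show ?thesis using dvd by metis
qed

lemma mat_rank_eq_length_invariant_divisors:
  fixes B :: "'m :: nontriv mod_ring mat"
  assumes p: "prime CARD('m)" and ds: "invariant_divisors B ds"
  shows "mat_rank B = length ds"
proof -
  let ?k = "dim_row B" and ?n = "dim_col B"
  let ?K = "class_ring :: 'm mod_ring ring" and ?V = "module_vec TYPE('m mod_ring) (dim_row B)"
  interpret V: vectorspace ?K ?V
    by (intro vectorspace.intro module_module_vec field_class_ring_mod_ring[OF p])
  have sub: "set (cols B) \<subseteq> carrier ?V" using cols_dim[of B] by (simp add: module_vec_simps)
  have vs: "vectorspace ?K (V.vs (V.span (set (cols B))))"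
    by (rule V.subspace_is_vs[OF V.span_is_subspace[OF sub]])
  have "card (V.span (set (cols B))) = CARD('m) ^ length ds"
    using span_cols_eq_range[of B ?k ?n] prime_invariant_divisors_eq_1[OF ds p]
      card_range_mult_mat_vec[of B ?k ?n ds] ds by simp
  \<comment> \<open>A positive cardinality excludes the default value 0 of infinite sets.\<close>
  moreover have "finite (V.span (set (cols B)))"
    using calculation by (intro card_ge_0_finite) simp
  \<comment> \<open>Two counts of the column space: through the Smith form and through its
    dimension.\<close>
  ultimately have "CARD('m) ^ length ds = CARD('m) ^ mat_rank B"
    using vectorspace.card_carrier_eq[OF vs] by (simp add: mat_rank_def)
  then show ?thesis using nontriv[where ?'a = 'm] by simp
qed

section \<open>Cartesian products\<close>

lemma incidence_mat_carrier: "incidence_mat vs es \<in> carrier_mat (length es) (length vs)"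
  by (simp add: incidence_mat_def)

lemma incidence_mat_mult_index:
  fixes x :: "'a \<Rightarrow> nat \<Rightarrow> 'r :: comm_ring_1"
  assumes vs: "enumerates vs V" and e: "es ! i \<subseteq> V" and ij: "i < length es" "j < l"
  shows "(incidence_mat vs es * mat (length vs) l (\<lambda>(t, j). x (vs ! t) j)) $$ (i, j) = (\<Sum>v\<in>es ! i. x v j)"
proof -
  have "finite V" using vs by (auto simp: enumerates_def)
  have "(incidence_mat vs es * mat (length vs) l (\<lambda>(t, j). x (vs ! t) j)) $$ (i, j) =
      (\<Sum>t<length vs. (if vs ! t \<in> es ! i then 1 else 0) * x (vs ! t) j)"
    using ij by (simp add: incidence_mat_def scalar_prod_def atLeast0LessThan)
  also have "\<dots> = (\<Sum>v\<in>V. (if v \<in> es ! i then 1 else 0) * x v j)"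
    by (rule sum.reindex_bij_betw[OF bij_betw_nth_enumerates[OF vs]])
  also have "\<dots> = (\<Sum>v\<in>es ! i. x v j)"
    using e \<open>finite V\<close> by (intro sum.mono_neutral_cong_right) auto
  finally show ?thesis .
qed

text \<open>Each column of the right factor is a function on the vertices, and multiplication
  produces its edge sums. The number \<open>l\<close> of columns is free in order to cover a matrix,
  its transpose and the all-one column.\<close>

lemma incidence_mat_mult_eq_0_iff:
  fixes x :: "'a \<Rightarrow> nat \<Rightarrow> 'r :: comm_ring_1"
  assumes vs: "enumerates vs V" and es: "enumerates es E" and sub: "\<And>e. e \<in> E \<Longrightarrow> e \<subseteq> V"
  shows "incidence_mat vs es * mat (length vs) l (\<lambda>(t, j). x (vs ! t) j) = 0\<^sub>m (length es) l \<longleftrightarrow>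
    (\<forall>e\<in>E. \<forall>j<l. (\<Sum>v\<in>e. x v j) = 0)" (is "?A = _ \<longleftrightarrow> ?R")
proof -
  have setes: "set es = E" using es by (simp add: enumerates_def)
  have idx: "?A $$ (i, j) = (\<Sum>v\<in>es ! i. x v j)" if "i < length es" "j < l" for i j
  proof (rule incidence_mat_mult_index[OF vs _ that])
    show "es ! i \<subseteq> V" using that setes nth_mem by (intro sub) auto
  qed
  have dims: "dim_row ?A = length es" "dim_col ?A = l" by (simp_all add: incidence_mat_def)
  show ?thesis
  proof
    assume A: "?A = 0\<^sub>m (length es) l"
    show ?R
    proof (intro ballI allI impI)
      fix e j assume "e \<in> E" "j < l"
      then obtain i where "i < length es" "es ! i = e" using setes by (metis in_set_conv_nth)
      then show "(\<Sum>v\<in>e. x v j) = 0" using idx[of i j] \<open>j < l\<close> unfolding A by simp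
    qed
  next
    assume R: ?R
    show "?A = 0\<^sub>m (length es) l"
    proof (rule eq_matI)
      fix i j assume "i < dim_row (0\<^sub>m (length es) l :: 'r mat)" "j < dim_col (0\<^sub>m (length es) l :: 'r mat)"
      then have ij: "i < length es" "j < l" by simp_all
      then have "es ! i \<in> E" using setes by auto
      then show "?A $$ (i, j) = 0\<^sub>m (length es) l $$ (i, j)" using R ij idx[OF ij] by simp
    qed (simp_all only: dims index_zero_mat)
  qed
qed

section \<open>Fewer invariant divisors than vertices\<close>

lemma dvd_chain:
  fixes ds :: "'a :: comm_monoid_mult list"
  assumes "\<And>i. Suc i < length ds \<Longrightarrow> ds ! i dvd ds ! Suc i" and "i \<le> j" "j < length ds"
  shows "ds ! i dvd ds ! j"
  using assms(2,3)
proof (induction j rule: dec_induct)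
  case (step j)
  then have "ds ! i dvd ds ! j" by simp
  also have "ds ! j dvd ds ! Suc j" using step.prems by (rule assms(1))
  finally show ?case .
qed simp

text \<open>The all-one vector is a kernel vector generating a free summand, so the Smith form must have a
  zero column.\<close>

lemma length_invariant_divisors_less:
  fixes B :: "'m :: nontriv mod_ring mat"
  assumes B: "B \<in> carrier_mat k n" and ds: "invariant_divisors B ds" and n: "n > 0"
    and ones: "B * mat n 1 (\<lambda>_. 1) = 0\<^sub>m k 1"
  shows "length ds < n"
proof (rule ccontr)
  assume "\<not> length ds < n"
  moreover have len: "length ds \<le> min k n" by (rule invariant_divisors_length[OF ds B])
  ultimately have r: "length ds = n" by simp
  obtain P P' Q Q' where
    P: "P \<in> carrier_mat k k" "P' \<in> carrier_mat k k" "P' * P = 1\<^sub>m k" and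
    Q: "Q \<in> carrier_mat n n" "Q' \<in> carrier_mat n n" "Q * Q' = 1\<^sub>m n"
    and PBQ: "P * B * Q = smith_diag k n ds" using invariant_divisorsE[OF ds B] by metis
  have chain: "\<And>i. Suc i < length ds \<Longrightarrow> ds ! i dvd ds ! Suc i"
    and bounds: "\<And>i. i < length ds \<Longrightarrow> 1 \<le> ds ! i \<and> ds ! i \<le> CARD('m) - 1"
    using ds unfolding invariant_divisors_def by blast+
  let ?u = "mat n 1 (\<lambda>_. 1) :: 'm mod_ring mat"
  \<comment> \<open>The all-one column in the coordinates given by \<open>Q\<close>.\<close>
  let ?Y = "Q' * ?u"
  \<comment> \<open>The last divisor is a multiple of all the others, so it annihilates every entry
    of \<open>?Y\<close> and hence \<open>?u\<close>, whose entries are 1.\<close>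
  let ?d = "ds ! (n - 1)"
  have Y: "?Y \<in> carrier_mat n 1" using Q by simp
  have QY: "Q * ?Y = ?u" using assoc_mult_mat[OF Q(1,2), of ?u 1] Q(3) by simp
  have one: "(1\<^sub>m 1 :: 'm mod_ring mat) * 1\<^sub>m 1 = 1\<^sub>m 1" by simp
  have "B * (Q * ?Y * 1\<^sub>m 1) = 0\<^sub>m k 1" unfolding QY using ones by simp
  then have "smith_diag k n ds * ?Y = 0\<^sub>m k 1"
    using smith_mult_eq_0_iff[OF B P Q(1) PBQ Y one_carrier_mat one_carrier_mat one] by blast
  then have tors: "of_nat (ds ! i) * ?Y $$ (i, 0) = 0" if "i < n" for i
    using that smith_diag_mult_eq_0_iff[OF len Y] r by (simp add: padded_divisor_def)
  have "of_nat ?d * ?Y $$ (i, 0) = 0" if "i < n" for i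
  proof -
    have "ds ! i dvd ?d" using that r by (intro dvd_chain[OF chain]) auto
    then obtain c where "?d = ds ! i * c" by (elim dvdE)
    then have "of_nat ?d * ?Y $$ (i, 0) = of_nat c * (of_nat (ds ! i) * ?Y $$ (i, 0))"
      by (simp add: mult_ac)
    then show ?thesis using tors[OF that] by simp
  qed
  then have "of_nat ?d \<cdot>\<^sub>m ?Y = 0\<^sub>m n 1" using Y by (intro eq_matI) auto
  then have "Q * (of_nat ?d \<cdot>\<^sub>m ?Y) = 0\<^sub>m n 1" using Q by simp
  then have "of_nat ?d \<cdot>\<^sub>m ?u = 0\<^sub>m n 1" using mult_smult_distrib[OF Q(1) Y] QY by metis
  then have "(of_nat ?d \<cdot>\<^sub>m ?u) $$ (0, 0) = 0" using n by simp
  then have "(of_nat ?d :: 'm mod_ring) = 0" using n by simp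
  then have "CARD('m) dvd ?d" by (simp only: of_nat_mod_ring_eq_0_iff)
  moreover have "1 \<le> ?d" "?d \<le> CARD('m) - 1"
    using bounds[of "n - 1"] n r by simp_all
  ultimately show False using dvd_imp_le[of "CARD('m)" ?d] nontriv[where ?'a = 'm] by linarith
qed

text \<open>Each edge sum of the all-one vector is \<open>CARD('m)\<close>, which is zero. The
  strict inequality makes the exponent in the final formula a genuine predecessor.\<close>

lemma incidence_mat_length_less:
  assumes uni: "uniform_hypergraph CARD('m) V E" and vs: "enumerates vs V" and es: "enumerates es E"
    and ds: "invariant_divisors (incidence_mat vs es :: 'm :: nontriv mod_ring mat) ds"
  shows "length ds < card V"
proof -
  have V: "card V = length vs" "card V > 0"
    using uni vs by (auto simp: uniform_hypergraph_def enumerates_def distinct_card)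
  have "incidence_mat vs es * mat (length vs) 1 (\<lambda>(t, j). 1 :: 'm mod_ring) = 0\<^sub>m (length es) 1"
    using incidence_mat_mult_eq_0_iff[OF vs es, of 1 "\<lambda>_ _. 1 :: 'm mod_ring"] uni
    by (auto simp: uniform_hypergraph_def)
  moreover have "(\<lambda>(t :: nat, j :: nat). 1 :: 'm mod_ring) = (\<lambda>_. 1)" by auto
  ultimately show ?thesis
    using length_invariant_divisors_less[OF incidence_mat_carrier ds] V by simp
qed

section \<open>The kernel of the Cartesian product as a set of matrices\<close>

lemma sum_cartesian_singletons:
  "(\<Sum>p\<in>{i} \<times> f. x p) = (\<Sum>b\<in>f. x (i, b))" "(\<Sum>p\<in>e \<times> {j}. x p) = (\<Sum>a\<in>e. x (a, j))"
proof -
  have "{i} \<times> f = Pair i ` f" "e \<times> {j} = (\<lambda>a. (a, j)) ` e" by auto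
  then show "(\<Sum>p\<in>{i} \<times> f. x p) = (\<Sum>b\<in>f. x (i, b))" "(\<Sum>p\<in>e \<times> {j}. x p) = (\<Sum>a\<in>e. x (a, j))"
    by (simp_all add: sum.reindex inj_on_def)
qed

text \<open>A function on pairs is a matrix \<open>X\<close>. Edges \<open>e \<times> {j}\<close>
  give the equations for its columns, edges \<open>{i} \<times> f\<close> those for its rows, that
  is, for the columns of \<open>X\<^sup>T\<close>.\<close>

lemma card_edge_kernel_cartesian:
  fixes V1 :: "'a set" and V2 :: "'b set"
  assumes vs1: "enumerates vs1 V1" and es1: "enumerates es1 E1" and sub1: "\<And>e. e \<in> E1 \<Longrightarrow> e \<subseteq> V1"
    and vs2: "enumerates vs2 V2" and es2: "enumerates es2 E2" and sub2: "\<And>e. e \<in> E2 \<Longrightarrow> e \<subseteq> V2"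
  shows "card (edge_kernel (V1 \<times> V2) (cartesian_edges V1 E1 V2 E2) :: ('a \<times> 'b \<Rightarrow> 'r :: comm_ring_1) set) =
    card {X :: 'r mat. X \<in> carrier_mat (length vs1) (length vs2) \<and>
      incidence_mat vs1 es1 * X = 0\<^sub>m (length es1) (length vs2) \<and>
      incidence_mat vs2 es2 * X\<^sup>T = 0\<^sub>m (length es2) (length vs1)}" (is "card ?K = card ?M")
proof -
  let ?n1 = "length vs1" and ?n2 = "length vs2"
  define M where "M x = mat ?n1 ?n2 (\<lambda>(i, j). x (vs1 ! i, vs2 ! j) :: 'r)" for x
  have V: "set vs1 = V1" "set vs2 = V2" using vs1 vs2 by (auto simp: enumerates_def)
  have all1: "(\<forall>i<?n1. R (vs1 ! i)) \<longleftrightarrow> (\<forall>a\<in>V1. R a)" for R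
    unfolding V(1)[symmetric] by (metis in_set_conv_nth)
  have all2: "(\<forall>j<?n2. R (vs2 ! j)) \<longleftrightarrow> (\<forall>b\<in>V2. R b)" for R
    unfolding V(2)[symmetric] by (metis in_set_conv_nth)
  have M_mem: "M x \<in> ?M \<longleftrightarrow> (\<forall>e\<in>cartesian_edges V1 E1 V2 E2. (\<Sum>p\<in>e. x p) = 0)" for x
  proof -
    have "incidence_mat vs1 es1 * M x = 0\<^sub>m (length es1) ?n2 \<longleftrightarrow>
        (\<forall>e\<in>E1. \<forall>j<?n2. (\<Sum>a\<in>e. x (a, vs2 ! j)) = 0)"
      unfolding M_def by (rule incidence_mat_mult_eq_0_iff[OF vs1 es1 sub1])
    also have "\<dots> \<longleftrightarrow> (\<forall>e\<in>E1. \<forall>b\<in>V2. (\<Sum>p\<in>e \<times> {b}. x p) = 0)"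
      unfolding sum_cartesian_singletons using all2[of "\<lambda>b. (\<Sum>a\<in>_. x (a, b)) = 0"] by (rule ball_cong[OF refl])
    finally have 1: "incidence_mat vs1 es1 * M x = 0\<^sub>m (length es1) ?n2 \<longleftrightarrow>
      (\<forall>e\<in>E1. \<forall>b\<in>V2. (\<Sum>p\<in>e \<times> {b}. x p) = 0)" .
    have "(M x)\<^sup>T = mat ?n2 ?n1 (\<lambda>(j, i). x (vs1 ! i, vs2 ! j))"
      by (intro eq_matI) (auto simp: M_def)
    then have "incidence_mat vs2 es2 * (M x)\<^sup>T = 0\<^sub>m (length es2) ?n1 \<longleftrightarrow>
        (\<forall>e\<in>E2. \<forall>i<?n1. (\<Sum>b\<in>e. x (vs1 ! i, b)) = 0)"
      using incidence_mat_mult_eq_0_iff[OF vs2 es2 sub2, of ?n1 "\<lambda>b i. x (vs1 ! i, b)"] by simp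
    also have "\<dots> \<longleftrightarrow> (\<forall>e\<in>E2. \<forall>a\<in>V1. (\<Sum>p\<in>{a} \<times> e. x p) = 0)"
      unfolding sum_cartesian_singletons using all1[of "\<lambda>a. (\<Sum>b\<in>_. x (a, b)) = 0"] by (rule ball_cong[OF refl])
    finally have 2: "incidence_mat vs2 es2 * (M x)\<^sup>T = 0\<^sub>m (length es2) ?n1 \<longleftrightarrow>
        (\<forall>e\<in>E2. \<forall>a\<in>V1. (\<Sum>p\<in>{a} \<times> e. x p) = 0)" .
    have "M x \<in> carrier_mat ?n1 ?n2" by (simp add: M_def)
    then show ?thesis
      unfolding mem_Collect_eq 1 2 cartesian_edges_def by blast
  qed
  have "bij_betw M ?K ?M"
    unfolding bij_betw_def
  proof (intro conjI inj_onI equalityI subsetI)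
    fix x y assume x: "x \<in> ?K" and y: "y \<in> ?K" and eq: "M x = M y"
    have xe: "x \<in> (V1 \<times> V2) \<rightarrow>\<^sub>E UNIV" and ye: "y \<in> (V1 \<times> V2) \<rightarrow>\<^sub>E UNIV"
      using x y by (auto simp: edge_kernel_def)
    show "x = y"
    proof (rule PiE_ext[OF xe ye])
      fix p assume "p \<in> V1 \<times> V2"
      then obtain i j where ij: "i < ?n1" "j < ?n2" "p = (vs1 ! i, vs2 ! j)"
        unfolding V[symmetric] by (auto simp: in_set_conv_nth)
      have "M x $$ (i, j) = M y $$ (i, j)" unfolding eq ..
      then show "x p = y p" using ij by (simp add: M_def)
    qed
  next
    fix X assume "X \<in> M ` ?K"
    then show "X \<in> ?M" using M_mem unfolding edge_kernel_def by blast
  next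
    fix X assume X: "X \<in> ?M"
    define g1 where "g1 = inv_into {..<?n1} ((!) vs1)"
    define g2 where "g2 = inv_into {..<?n2} ((!) vs2)"
    define x where "x = restrict (\<lambda>(a, b). X $$ (g1 a, g2 b)) (V1 \<times> V2)"
    have g1: "g1 (vs1 ! i) = i" if "i < ?n1" for i
      using bij_betw_nth_enumerates[OF vs1] that by (auto simp: g1_def bij_betw_def)
    have g2: "g2 (vs2 ! j) = j" if "j < ?n2" for j
      using bij_betw_nth_enumerates[OF vs2] that by (auto simp: g2_def bij_betw_def)
    have "x (vs1 ! i, vs2 ! j) = X $$ (i, j)" if "i < ?n1" "j < ?n2" for i j
      using that g1 g2 V nth_mem by (auto simp: x_def)
    then have MX: "M x = X" using X by (intro eq_matI) (auto simp: M_def)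
    then have "x \<in> ?K" using X M_mem[of x] by (simp add: edge_kernel_def x_def)
    then show "X \<in> M ` ?K" using MX by blast
  qed
  then show ?thesis by (rule bij_betw_same_card)
qed

section \<open>Evaluating the product of gcds\<close>

lemma prod_padded_divisor:
  fixes f :: "nat \<Rightarrow> 'c :: comm_monoid_mult"
  assumes "length ds \<le> n"
  shows "(\<Prod>i<n. f (padded_divisor m ds i)) = (\<Prod>i<length ds. f (ds ! i)) * f m ^ (n - length ds)"
proof -
  have "{..<n} = {..<length ds} \<union> {length ds..<n}" using assms by auto
  then have "(\<Prod>i<n. f (padded_divisor m ds i)) =
      (\<Prod>i<length ds. f (padded_divisor m ds i)) * (\<Prod>i\<in>{length ds..<n}. f (padded_divisor m ds i))"
    by (simp add: prod.union_disjoint ivl_disj_int)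
  then show ?thesis by (simp add: padded_divisor_def)
qed

text \<open>The index grid splits into four blocks: genuine divisors on both sides give gcds, one
  padded side leaves the other divisor since it divides \<open>m\<close>, and two padded sides give
  \<open>m\<close>.\<close>

lemma prod_gcd_padded_divisor:
  assumes "length ds1 \<le> n1" "length ds2 \<le> n2"
    and d1: "\<And>i. i < length ds1 \<Longrightarrow> ds1 ! i dvd m" and d2: "\<And>j. j < length ds2 \<Longrightarrow> ds2 ! j dvd m"
  shows "(\<Prod>i<n1. \<Prod>j<n2. gcd (padded_divisor m ds1 i) (padded_divisor m ds2 j)) =
    m ^ ((n1 - length ds1) * (n2 - length ds2))
    * (\<Prod>i<length ds1. \<Prod>j<length ds2. gcd (ds1 ! i) (ds2 ! j))
    * (\<Prod>i<length ds1. (ds1 ! i) ^ (n2 - length ds2))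
    * (\<Prod>j<length ds2. (ds2 ! j) ^ (n1 - length ds1))"
proof -
  have "(\<Prod>i<n1. \<Prod>j<n2. gcd (padded_divisor m ds1 i) (padded_divisor m ds2 j)) =
     (\<Prod>i<length ds1. (\<Prod>j<length ds2. gcd (ds1 ! i) (ds2 ! j)) * gcd (ds1 ! i) m ^ (n2 - length ds2)) *
     ((\<Prod>j<length ds2. gcd m (ds2 ! j)) * gcd m m ^ (n2 - length ds2)) ^ (n1 - length ds1)"
    unfolding prod_padded_divisor[OF assms(2)]
    by (rule prod_padded_divisor[OF assms(1)])
  also have "(\<Prod>j<length ds2. gcd m (ds2 ! j)) = (\<Prod>j<length ds2. ds2 ! j)"
    using d2 by (intro prod.cong) (auto simp: gcd_nat.absorb2)
  also have "(\<Prod>i<length ds1. (\<Prod>j<length ds2. gcd (ds1 ! i) (ds2 ! j)) * gcd (ds1 ! i) m ^ (n2 - length ds2)) =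
      (\<Prod>i<length ds1. (\<Prod>j<length ds2. gcd (ds1 ! i) (ds2 ! j)) * (ds1 ! i) ^ (n2 - length ds2))"
    using d1 by (intro prod.cong) (auto simp: gcd_nat.absorb1)
  also have "((\<Prod>j<length ds2. ds2 ! j) * gcd m m ^ (n2 - length ds2)) ^ (n1 - length ds1) =
      (\<Prod>j<length ds2. (ds2 ! j) ^ (n1 - length ds1)) * m ^ ((n1 - length ds1) * (n2 - length ds2))"
    by (simp add: power_mult_distrib prod_power_distrib mult.commute flip: power_mult)
  finally show ?thesis by (simp add: prod.distrib)
qed

theorem theorem3p6:
  fixes m :: nat
    and V1 :: "'a set" and E1 :: "'a set set" and V2 :: "'b set" and E2 :: "'b set set"
    and vs1 :: "'a list" and es1 :: "'a set list" and vs2 :: "'b list" and es2 :: "'b set list"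
    and vs :: "('a \<times> 'b) list"
    and ds1 ds2 :: "nat list"
  assumes "m = CARD('m :: nontriv)" and "m \<ge> 2"
    and "uniform_hypergraph m V1 E1" and "hypergraph_connected V1 E1"
    and "uniform_hypergraph m V2 E2" and "hypergraph_connected V2 E2"
    and "enumerates vs1 V1" and "enumerates es1 E1"
    and "enumerates vs2 V2" and "enumerates es2 E2"
    and "enumerates vs (V1 \<times> V2)"
    and "invariant_divisors (incidence_mat vs1 es1 :: 'm mod_ring mat) ds1"
    and "invariant_divisors (incidence_mat vs2 es2 :: 'm mod_ring mat) ds2"
  shows
    "stabilizing_index m vs (cartesian_edges V1 E1 V2 E2) =
       m ^ ((card V1 - length ds1) * (card V2 - length ds2) - 1)
       * (\<Prod>i<length ds1. \<Prod>j<length ds2. gcd (ds1 ! i) (ds2 ! j))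
       * (\<Prod>i<length ds1. (ds1 ! i) ^ (card V2 - length ds2))
       * (\<Prod>j<length ds2. (ds2 ! j) ^ (card V1 - length ds1))
     \<and> (prime m \<longrightarrow>
          length ds1 = mat_rank (incidence_mat vs1 es1 :: 'm mod_ring mat) \<and>
          length ds2 = mat_rank (incidence_mat vs2 es2 :: 'm mod_ring mat) \<and>
          stabilizing_index m vs (cartesian_edges V1 E1 V2 E2) =
            m ^ ((card V1 - length ds1) * (card V2 - length ds2) - 1))"
proof -
  note m = assms(1) and uni1 = assms(3) and conn1 = assms(4) and uni2 = assms(5) and conn2 = assms(6)
    and vs1 = assms(7) and es1 = assms(8) and vs2 = assms(9) and es2 = assms(10) and vs = assms(11)
    and ds1 = assms(12) and ds2 = assms(13)
  let ?E = "cartesian_edges V1 E1 V2 E2" and ?s = "stabilizing_index m vs (cartesian_edges V1 E1 V2 E2)"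
  let ?r1 = "length ds1" and ?r2 = "length ds2" and ?n1 = "card V1" and ?n2 = "card V2"
  let ?c = "(?n1 - ?r1) * (?n2 - ?r2)"
  let ?rest = "(\<Prod>i<?r1. \<Prod>j<?r2. gcd (ds1 ! i) (ds2 ! j)) * (\<Prod>i<?r1. (ds1 ! i) ^ (?n2 - ?r2))
    * (\<Prod>j<?r2. (ds2 ! j) ^ (?n1 - ?r1))"
  have n: "?n1 = length vs1" "?n2 = length vs2"
    using vs1 vs2 by (auto simp: enumerates_def distinct_card)
  have less: "?r1 < ?n1" "?r2 < ?n2"
    using incidence_mat_length_less[OF uni1[unfolded m] vs1 es1 ds1]
      incidence_mat_length_less[OF uni2[unfolded m] vs2 es2 ds2] by simp_all
  have sub1: "e \<subseteq> V1" if "e \<in> E1" for e using uni1 that by (auto simp: uniform_hypergraph_def)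
  have sub2: "e \<subseteq> V2" if "e \<in> E2" for e using uni2 that by (auto simp: uniform_hypergraph_def)
  have dvd1: "ds1 ! i dvd m" if "i < ?r1" for i using ds1 that m by (auto simp: invariant_divisors_def)
  have dvd2: "ds2 ! i dvd m" if "i < ?r2" for i using ds2 that m by (auto simp: invariant_divisors_def)
  \<comment> \<open>Connectedness of the two factors is passed on as constancy of edgewise constant
    functions on the product.\<close>
  have "m * ?s = card (edge_kernel (V1 \<times> V2) ?E :: ('a \<times> 'b \<Rightarrow> 'm mod_ring) set)"
    unfolding m
    by (rule stabilizing_index_eq_card_edge_kernel[OF uniform_cartesian[OF uni1[unfolded m] uni2[unfolded m]]
          cartesian_edgewise_constant[OF conn1 conn2] vs])
  also have "\<dots> = card {X :: 'm mod_ring mat. X \<in> carrier_mat ?n1 ?n2 \<and>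
      incidence_mat vs1 es1 * X = 0\<^sub>m (length es1) ?n2 \<and> incidence_mat vs2 es2 * X\<^sup>T = 0\<^sub>m (length es2) ?n1}"
    unfolding n by (rule card_edge_kernel_cartesian[OF vs1 es1 sub1 vs2 es2 sub2])
  also have "\<dots> = (\<Prod>i<?n1. \<Prod>j<?n2. gcd (padded_divisor m ds1 i) (padded_divisor m ds2 j))"
    unfolding n m by (rule card_two_sided_kernel[OF incidence_mat_carrier incidence_mat_carrier ds1 ds2])
  also have "\<dots> = m ^ ?c * ?rest"
    using prod_gcd_padded_divisor[OF less[THEN less_imp_le] dvd1 dvd2] by (simp add: mult.assoc)
  \<comment> \<open>Both factors of \<open>?c\<close> are positive by \<open>less\<close>, so one
    factor \<open>m\<close> splits off and cancels against the one on the left.\<close>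
  also have "m ^ ?c = m * m ^ (?c - 1)" using less by (cases ?c) auto
  finally have main: "?s = m ^ (?c - 1) * ?rest" using assms(2) by (simp add: mult.assoc)
  show ?thesis
  proof (intro conjI impI)
    show "?s = m ^ (?c - 1) * (\<Prod>i<?r1. \<Prod>j<?r2. gcd (ds1 ! i) (ds2 ! j))
       * (\<Prod>i<?r1. (ds1 ! i) ^ (?n2 - ?r2)) * (\<Prod>j<?r2. (ds2 ! j) ^ (?n1 - ?r1))"
      using main by (simp add: mult.assoc)
    assume p: "prime m"
    show "?r1 = mat_rank (incidence_mat vs1 es1 :: 'm mod_ring mat)"
      "?r2 = mat_rank (incidence_mat vs2 es2 :: 'm mod_ring mat)"
      using mat_rank_eq_length_invariant_divisors p m ds1 ds2 by metis+
    have "ds1 ! i = 1" if "i < ?r1" for i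
      using prime_invariant_divisors_eq_1[OF ds1] p m that by blast
    moreover have "ds2 ! i = 1" if "i < ?r2" for i
      using prime_invariant_divisors_eq_1[OF ds2] p m that by blast
    \<comment> \<open>For prime \<open>m\<close> all invariant divisors are 1, so only the power of
      \<open>m\<close> survives.\<close>
    ultimately have "?rest = 1" by simp
    then show "?s = m ^ (?c - 1)" using main by simp
  qed
qed

end
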